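(* Let $\bullet$ be nothing, "$\leq 1$" or "$1$". The projective limit of a projective system $(p_{ij} \colon X_j \to X_i)_{i \sqsubseteq j \in I}$ of topological spaces is preserved by $\mathcal Q_{\mathsf V}^{cvx} \mathbf V_\bullet$ if and only if it is preserved by $\mathbf V_\bullet$.
   Context: $\mathcal O X$ is the lattice of open subsets of $X$. The specialization preordering is: $x \leq y$ iff every open neighborhood of $x$ contains $y$; $\uparrow A$ denotes upward closure. A subset is saturated iff it is upwards-closed. Compactness is the open cover property, with no separation axiom. A projective system $(p_{ij} \colon X_j \to X_i)_{i \sqsubseteq j \in I}$ consists of a directed preordered set $(I,\sqsubseteq)$, spaces $X_i$, and continuous maps $p_{ij}$ ($i \sqsubseteq j$) with $p_{ii} = \mathrm{id}$ and $p_{ij} \circ p_{jk} = p_{ik}$ for $i \sqsubseteq j \sqsubseteq k$. Its canonical projective limit is $X = \{\vec x \in \prod_{i} X_i \mid p_{ij}(x_j) = x_i \text{ for all } i \sqsubseteq j\}$ with the subspace topology of the product, $p_i$ being projection onto coordinate $i$. It is preserved by an endofunctor $T$ on topological spaces iff, $Z$ being the canonical projective limit of $(Tp_{ij} \colon TX_j \to TX_i)_{i \sqsubseteq j}$, the comparison map $TX \to Z$, $t \mapsto (Tp_i(t))_{i \in I}$, is a homeomorphism. A continuous valuation on $X$ is a Scott-continuous map $\nu \colon \mathcal O X \to \overline{\mathbb R}_+ = \mathbb R_+ \cup \{\infty\}$ with $\nu(\emptyset)=0$ and $\nu(U)+\nu(V)=\nu(U\cup V)+\nu(U\cap V)$.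 $\mathbf V X$ is the space of continuous valuations with the topology generated by $\{\nu \mid \nu(U)>r\}$, $U \in \mathcal O X$, $r \in \mathbb R_+$ (its specialization ordering is the pointwise ordering); $\mathbf V_{\leq 1} X$ and $\mathbf V_1 X$ are the subspaces where $\nu(X)\leq 1$, resp. $\nu(X)=1$. A continuous map $f$ acts by $\mathbf V f(\nu) = (V \mapsto \nu(f^{-1}(V)))$. $\mathbf V_\bullet$ is $\mathbf V$, $\mathbf V_{\leq 1}$ or $\mathbf V_1$ according to $\bullet$. $\mathcal Q_{\mathsf V}^{cvx} \mathbf V_\bullet X$ is the set of non-empty convex compact saturated subsets $Q$ of $\mathbf V_\bullet X$ (convex: closed under $r\nu_1+(1-r)\nu_2$, $r \in [0,1]$), with the upper Vietoris topology, whose basic open sets are $\{Q \mid Q \subseteq \mathcal U\}$, $\mathcal U$ open in $\mathbf V_\bullet X$. It is an endofunctor on topological spaces; a continuous map $f \colon X \to Y$ acts by $Q \mapsto \uparrow \{\mathbf V f(\nu) \mid \nu \in Q\}$ (upward closure in $\mathbf V_\bullet Y$). *)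

theory Defs
  imports "HOL-Analysis.Analysis"
begin

subsection \<open>Projective systems and their limits\<close>

definition directed_preordered :: "'i set \<Rightarrow> ('i \<Rightarrow> 'i \<Rightarrow> bool) \<Rightarrow> bool" where
  "directed_preordered I le \<longleftrightarrow>
     reflp_on I le \<and> transp_on I le \<and>
     I \<noteq> {} \<and> (\<forall>i\<in>I. \<forall>j\<in>I. \<exists>k\<in>I. le i k \<and> le j k)"

text \<open>The map \<open>p i j\<close> goes from \<open>X j\<close> to \<open>X i\<close> when \<open>le i j\<close>.
  The bonding maps are total functions; only their values on \<open>topspace (X j)\<close> matter.\<close>

definition projective_system ::
  "'i set \<Rightarrow> ('i \<Rightarrow> 'i \<Rightarrow> bool) \<Rightarrow> ('i \<Rightarrow> 'a topology) \<Rightarrow> ('i \<Rightarrow> 'i \<Rightarrow> 'a \<Rightarrow> 'a) \<Rightarrow> bool" where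
  "projective_system I le X p \<longleftrightarrow>
     directed_preordered I le \<and>
     (\<forall>i\<in>I. \<forall>j\<in>I. le i j \<longrightarrow> continuous_map (X j) (X i) (p i j)) \<and>
     (\<forall>i\<in>I. \<forall>x\<in>topspace (X i). p i i x = x) \<and>
     (\<forall>i\<in>I. \<forall>j\<in>I. \<forall>k\<in>I. le i j \<longrightarrow> le j k \<longrightarrow>
        (\<forall>x\<in>topspace (X k). p i j (p j k x) = p i k x))"

definition projective_limit ::
  "'i set \<Rightarrow> ('i \<Rightarrow> 'i \<Rightarrow> bool) \<Rightarrow> ('i \<Rightarrow> 'a topology) \<Rightarrow> ('i \<Rightarrow> 'i \<Rightarrow> 'a \<Rightarrow> 'a)
     \<Rightarrow> ('i \<Rightarrow> 'a) topology" where
  "projective_limit I le X p =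
     subtopology (product_topology X I)
       {x. \<forall>i\<in>I. \<forall>j\<in>I. le i j \<longrightarrow> p i j (x j) = x i}"

text \<open>A functor \<open>T\<close> cannot be passed as an argument, because it is applied at two
  different types: at the spaces \<open>X i\<close> and at their limit. So the following takes the data
  obtained by applying \<open>T\<close>: the system \<open>TX i = T (X i)\<close>, \<open>Tp i j = T (p i j)\<close>, the space
  \<open>TL = T L\<close> where \<open>L\<close> is the limit, and the images \<open>Tpr i\<close> of the projections
  from \<open>L\<close> to \<open>X i\<close>.\<close>

definition limit_preserved ::
  "'i set \<Rightarrow> ('i \<Rightarrow> 'i \<Rightarrow> bool) \<Rightarrow> ('i \<Rightarrow> 'b topology) \<Rightarrow> ('i \<Rightarrow> 'i \<Rightarrow> 'b \<Rightarrow> 'b)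
     \<Rightarrow> 'c topology \<Rightarrow> ('i \<Rightarrow> 'c \<Rightarrow> 'b) \<Rightarrow> bool" where
  "limit_preserved I le TX Tp TL Tpr \<longleftrightarrow>
     homeomorphic_map TL (projective_limit I le TX Tp) (\<lambda>t. \<lambda>i\<in>I. Tpr i t)"


subsection \<open>Specialization preordering\<close>

definition specializes :: "'a topology \<Rightarrow> 'a \<Rightarrow> 'a \<Rightarrow> bool" where
  "specializes X x y \<longleftrightarrow> x \<in> topspace X \<and> y \<in> topspace X \<and>
     (\<forall>U. openin X U \<longrightarrow> x \<in> U \<longrightarrow> y \<in> U)"

definition upward_closure :: "'a topology \<Rightarrow> 'a set \<Rightarrow> 'a set" where
  "upward_closure X A = {y. \<exists>x\<in>A. specializes X x y}"

definition saturatedin :: "'a topology \<Rightarrow> 'a set \<Rightarrow> bool" where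
  "saturatedin X A \<longleftrightarrow> A \<subseteq> topspace X \<and> (\<forall>x\<in>A. \<forall>y. specializes X x y \<longrightarrow> y \<in> A)"


subsection \<open>Continuous valuations\<close>

text \<open>Scott continuity is spelled out as monotonicity plus preservation of directed suprema.
  A valuation is only defined on open sets; requiring it to be \<^term>\<open>extensional\<close> makes
  equality of functions coincide with equality of valuations.\<close>

definition continuous_valuation :: "'a topology \<Rightarrow> ('a set \<Rightarrow> ennreal) \<Rightarrow> bool" where
  "continuous_valuation X \<nu> \<longleftrightarrow>
     \<nu> \<in> extensional {U. openin X U} \<and>
     \<nu> {} = 0 \<and>
     (\<forall>U V. openin X U \<longrightarrow> openin X V \<longrightarrow> \<nu> U + \<nu> V = \<nu> (U \<union> V) + \<nu> (U \<inter> V)) \<and>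
     mono_on {U. openin X U} \<nu> \<and>
     (\<forall>D. D \<subseteq> {U. openin X U} \<longrightarrow> D \<noteq> {} \<longrightarrow> (\<forall>U\<in>D. \<forall>V\<in>D. \<exists>W\<in>D. U \<subseteq> W \<and> V \<subseteq> W) \<longrightarrow>
        \<nu> (\<Union>D) = (SUP U\<in>D. \<nu> U))"

text \<open>The full carrier is inserted explicitly among the generators because
  \<^const>\<open>topology_generated_by\<close> takes their union as underlying space, and
  the zero valuation belongs to none of the sets \<open>{\<nu>. \<nu> U > r}\<close>.\<close>

definition valuation_topology :: "'a topology \<Rightarrow> ('a set \<Rightarrow> ennreal) topology" where
  "valuation_topology X =
     topology_generated_by
       (insert {\<nu>. continuous_valuation X \<nu>}
         {{\<nu>. continuous_valuation X \<nu> \<and> ennreal r < \<nu> U} | U r. openin X U \<and> 0 \<le> r})"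

datatype valuation_kind = Arbitrary | Subprobability | Probability

fun V_space :: "valuation_kind \<Rightarrow> 'a topology \<Rightarrow> ('a set \<Rightarrow> ennreal) topology" where
  "V_space Arbitrary X = valuation_topology X"
| "V_space Subprobability X =
     subtopology (valuation_topology X) {\<nu>. \<nu> (topspace X) \<le> 1}"
| "V_space Probability X =
     subtopology (valuation_topology X) {\<nu>. \<nu> (topspace X) = 1}"

definition V_map ::
  "'a topology \<Rightarrow> 'b topology \<Rightarrow> ('a \<Rightarrow> 'b) \<Rightarrow> ('a set \<Rightarrow> ennreal) \<Rightarrow> ('b set \<Rightarrow> ennreal)" where
  "V_map X Y f \<nu> = (\<lambda>V\<in>{V. openin Y V}. \<nu> {x \<in> topspace X. f x \<in> V})"


subsection \<open>Convex compact saturated sets of valuations\<close>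

definition convex_valuations :: "'a topology \<Rightarrow> ('a set \<Rightarrow> ennreal) set \<Rightarrow> bool" where
  "convex_valuations X Q \<longleftrightarrow>
     (\<forall>\<nu>1\<in>Q. \<forall>\<nu>2\<in>Q. \<forall>r::real. 0 \<le> r \<longrightarrow> r \<le> 1 \<longrightarrow>
        (\<lambda>U\<in>{U. openin X U}. ennreal r * \<nu>1 U + ennreal (1 - r) * \<nu>2 U) \<in> Q)"

definition QV_carrier :: "valuation_kind \<Rightarrow> 'a topology \<Rightarrow> ('a set \<Rightarrow> ennreal) set set" where
  "QV_carrier b X =
     {Q. Q \<noteq> {} \<and> convex_valuations X Q \<and> compactin (V_space b X) Q \<and> saturatedin (V_space b X) Q}"

definition QV_space :: "valuation_kind \<Rightarrow> 'a topology \<Rightarrow> ('a set \<Rightarrow> ennreal) set topology" where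
  "QV_space b X =
     topology_generated_by {{Q \<in> QV_carrier b X. Q \<subseteq> U} | U. openin (V_space b X) U}"

definition QV_map ::
  "valuation_kind \<Rightarrow> 'a topology \<Rightarrow> 'b topology \<Rightarrow> ('a \<Rightarrow> 'b)
     \<Rightarrow> ('a set \<Rightarrow> ennreal) set \<Rightarrow> ('b set \<Rightarrow> ennreal) set" where
  "QV_map b X Y f Q = upward_closure (V_space b Y) (V_map X Y f ` Q)"

definition V_preserves_limit ::
  "valuation_kind \<Rightarrow> 'i set \<Rightarrow> ('i \<Rightarrow> 'i \<Rightarrow> bool) \<Rightarrow> ('i \<Rightarrow> 'a topology)
     \<Rightarrow> ('i \<Rightarrow> 'i \<Rightarrow> 'a \<Rightarrow> 'a) \<Rightarrow> bool" where
  "V_preserves_limit b I le X p \<longleftrightarrow>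
     (let L = projective_limit I le X p in
      limit_preserved I le
        (\<lambda>i. V_space b (X i)) (\<lambda>i j. V_map (X j) (X i) (p i j))
        (V_space b L) (\<lambda>i. V_map L (X i) (\<lambda>x. x i)))"

definition QV_preserves_limit ::
  "valuation_kind \<Rightarrow> 'i set \<Rightarrow> ('i \<Rightarrow> 'i \<Rightarrow> bool) \<Rightarrow> ('i \<Rightarrow> 'a topology)
     \<Rightarrow> ('i \<Rightarrow> 'i \<Rightarrow> 'a \<Rightarrow> 'a) \<Rightarrow> bool" where
  "QV_preserves_limit b I le X p \<longleftrightarrow>
     (let L = projective_limit I le X p in
      limit_preserved I le
        (\<lambda>i. QV_space b (X i)) (\<lambda>i j. QV_map b (X j) (X i) (p i j))
        (QV_space b L) (\<lambda>i. QV_map b L (X i) (\<lambda>x. x i)))"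

lemma topspace_valuation_topology:
  "topspace (valuation_topology X) = {\<nu>. continuous_valuation X \<nu>}"
  unfolding valuation_topology_def topology_generated_by_topspace by auto

lemma topspace_QV_space: "topspace (QV_space b X) = QV_carrier b X"
proof -
  have "Q \<subseteq> topspace (V_space b X)" if "Q \<in> QV_carrier b X" for Q
    using that by (auto simp: QV_carrier_def saturatedin_def)
  then show ?thesis
    unfolding QV_space_def topology_generated_by_topspace by blast
qed

end

theory Submission
  imports Defs
begin

text \<open>
  Write \<open>V\<close> for the valuation functor of the given kind and \<open>Q\<close> for the functor that
  takes a space to the convex compact saturated subsets of its valuation space. The values of both
  are T0 spaces, and for a T0 space \<open>L\<close> with a cone \<open>q i\<close> over a projective system \<open>Y\<close> the
  comparison map into the limit is a homeomorphism exactly when every thread of \<open>Y\<close> comes from a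
  point of \<open>L\<close> and the preimages of open sets under the single maps \<open>q i\<close> form a base of \<open>L\<close>
  (\<open>homeomorphic_map_limit_iff\<close>). So there are a surjectivity condition and a base condition to
  transfer in each direction.

  From \<open>Q\<close> to \<open>V\<close>: the map \<open>\<nu> \<mapsto> \<up>\<nu>\<close> embeds \<open>V\<close> into \<open>Q\<close> naturally, which transfers the base
  condition. A thread \<open>x\<close> of valuations gives the thread of all \<open>\<up>x i\<close>, which comes from some
  compact \<open>K\<close>. For each \<open>i\<close> the elements of \<open>K\<close> whose image lies below \<open>x i\<close> form a nonempty
  closed subset of \<open>K\<close>; these subsets are filtered, so they have a common element, and all images
  of \<open>K\<close> are above \<open>x i\<close>, so this element has image exactly \<open>x i\<close> for every \<open>i\<close>.

  From \<open>V\<close> to \<open>Q\<close>: the base condition passes to compact sets because the index set is directed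
  (\<open>compact_basis\<close>). For surjectivity, a thread \<open>K i\<close> of compact sets has to come from
  \<open>{\<nu>. \<forall>i. q i \<nu> \<in> K i}\<close>. That this set is nonempty, compact, and maps onto each \<open>K i\<close> up to
  upward closure is a theorem of Steenrod type about projective systems of compact saturated sets
  in sober spaces. It applies because every space of continuous valuations is sober
  (\<open>sober_space_V_space\<close>): the supremum of an irreducible closed set of
  valuations is again a valuation, and it is the generic point. Convexity is inherited since the
  maps between valuation spaces are affine.

  The Steenrod argument (\<open>thread_in_transversal\<close>) takes, by Zorn's lemma, a minimal
  family of closed sets \<open>C i\<close> that meet \<open>K i\<close> and are compatible with the bonding maps.
  Minimality forces each \<open>C i\<close> to be irreducible, so by sobriety it is the closure of one point, and
  these points form the required thread.
\<close>

section \<open>Compactness, specialization and sobriety\<close>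

lemma compactin_directed_Union:
  assumes K: "compactin X K" and ne: "J \<noteq> {}"
    and op: "\<And>j. j \<in> J \<Longrightarrow> openin X (U j)"
    and dir: "\<And>i j. i \<in> J \<Longrightarrow> j \<in> J \<Longrightarrow> \<exists>k\<in>J. U i \<union> U j \<subseteq> U k"
    and cover: "K \<subseteq> (\<Union>j\<in>J. U j)"
  shows "\<exists>j\<in>J. K \<subseteq> U j"
proof -
  have fin: "\<exists>k\<in>J. \<Union>(U ` F) \<subseteq> U k" if "finite F" "F \<subseteq> J" for F
    using that
  proof (induction F)
    case empty
    then show ?case using ne by auto
  next
    case (insert x F)
    then obtain k where k: "k \<in> J" "\<Union>(U ` F) \<subseteq> U k" by auto
    obtain l where "l \<in> J" "U x \<union> U k \<subseteq> U l" using dir[of x k] insert.prems k by auto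
    then show ?case using k by (intro bexI[of _ l]) auto
  qed
  obtain \<F> where \<F>: "finite \<F>" "\<F> \<subseteq> U ` J" "K \<subseteq> \<Union>\<F>"
  proof -
    have "\<forall>V\<in>U ` J. openin X V" using op by blast
    then have "\<exists>\<F>. finite \<F> \<and> \<F> \<subseteq> U ` J \<and> K \<subseteq> \<Union>\<F>"
      using K cover unfolding compactin_def by simp
    then show ?thesis using that by blast
  qed
  obtain F where F: "F \<subseteq> J" "finite F" "\<F> = U ` F"
    using finite_subset_image[OF \<F>(1,2)] by metis
  obtain k where "k \<in> J" "\<Union>(U ` F) \<subseteq> U k" using fin[OF F(2,1)] by metis
  then show ?thesis using \<F>(3) F(3) order_trans by metis
qed

text \<open>The dual form of the previous lemma. It replaces the finite intersection property, since all
  families of closed sets considered here are filtered because they are indexed by a directed set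
  or by a chain.\<close>

lemma compactin_filtered_closed:
  assumes K: "compactin X K" and ne: "J \<noteq> {}"
    and cl: "\<And>j. j \<in> J \<Longrightarrow> closedin X (C j)"
    and dir: "\<And>i j. i \<in> J \<Longrightarrow> j \<in> J \<Longrightarrow> \<exists>k\<in>J. C k \<subseteq> C i \<inter> C j"
    and meet: "\<And>j. j \<in> J \<Longrightarrow> C j \<inter> K \<noteq> {}"
  shows "\<exists>x\<in>K. \<forall>j\<in>J. x \<in> C j"
proof (rule ccontr)
  assume neg: "\<not> ?thesis"
  have KX: "K \<subseteq> topspace X" using K compactin_subset_topspace by blast
  have "\<exists>j\<in>J. K \<subseteq> topspace X - C j"
  proof (rule compactin_directed_Union[OF K ne])
    show "openin X (topspace X - C j)" if "j \<in> J" for j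
      using cl[OF that] by auto
    show "\<exists>k\<in>J. topspace X - C i \<union> (topspace X - C j) \<subseteq> topspace X - C k"
      if "i \<in> J" "j \<in> J" for i j
      using dir[OF that] by blast
    show "K \<subseteq> (\<Union>j\<in>J. topspace X - C j)" using neg KX by auto
  qed
  then show False using meet by blast
qed

lemma specializes_refl: "x \<in> topspace X \<Longrightarrow> specializes X x x"
  by (auto simp: specializes_def)

lemma specializes_trans: "specializes X x y \<Longrightarrow> specializes X y z \<Longrightarrow> specializes X x z"
  by (auto simp: specializes_def)

lemma specializes_antisym: "t0_space X \<Longrightarrow> specializes X x y \<Longrightarrow> specializes X y x \<Longrightarrow> x = y"
  unfolding t0_space_def specializes_def by metis

lemma closure_of_singleton: 
  assumes "x \<in> topspace X" shows "X closure_of {x} = {z. specializes X z x}"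
  using assms by (auto simp: in_closure_of specializes_def)

lemma specializes_continuous_map:
  assumes "continuous_map X Y f" "specializes X x y"
  shows "specializes Y (f x) (f y)"
proof -
  have "f y \<in> U" if "openin Y U" "f x \<in> U" for U
    using openin_continuous_map_preimage[OF assms(1) that(1)] assms(2) that(2)
    unfolding specializes_def by blast
  moreover have "f x \<in> topspace Y" "f y \<in> topspace Y"
    using assms unfolding specializes_def continuous_map_def by auto
  ultimately show ?thesis by (auto simp: specializes_def)
qed

lemma upward_closure_subset_iff:
  assumes "openin X U" "A \<subseteq> topspace X"
  shows "upward_closure X A \<subseteq> U \<longleftrightarrow> A \<subseteq> U"
  using assms by (auto simp: upward_closure_def specializes_def)

lemma upward_closure_superset: "A \<subseteq> topspace X \<Longrightarrow> A \<subseteq> upward_closure X A"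
  by (auto simp: upward_closure_def specializes_def)

lemma saturatedin_upward_closure: "saturatedin X (upward_closure X A)"
proof -
  have "upward_closure X A \<subseteq> topspace X" by (auto simp: upward_closure_def specializes_def)
  moreover have "z \<in> upward_closure X A" if "y \<in> upward_closure X A" "specializes X y z" for y z
    using that specializes_trans[of X _ y z] unfolding upward_closure_def by blast
  ultimately show ?thesis by (auto simp: saturatedin_def)
qed

lemma upward_closure_saturated: "saturatedin X A \<Longrightarrow> upward_closure X A = A"
  by (auto simp: saturatedin_def upward_closure_def specializes_def)

lemma compactin_upward_closure:
  assumes "compactin X A" shows "compactin X (upward_closure X A)"
  unfolding compactin_def
proof (intro conjI allI impI)
  have A: "A \<subseteq> topspace X" using assms compactin_subset_topspace by blast
  show "upward_closure X A \<subseteq> topspace X" by (auto simp: upward_closure_def specializes_def)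
  fix \<U> assume \<U>: "(\<forall>U\<in>\<U>. openin X U) \<and> upward_closure X A \<subseteq> \<Union>\<U>"
  then have "A \<subseteq> \<Union>\<U>" using upward_closure_superset[OF A] by blast
  then obtain \<F> where \<F>: "finite \<F>" "\<F> \<subseteq> \<U>" "A \<subseteq> \<Union>\<F>"
    using assms \<U> unfolding compactin_def by meson
  have "openin X (\<Union>\<F>)" using \<F> \<U> by auto
  then have "upward_closure X A \<subseteq> \<Union>\<F>" using \<F> upward_closure_subset_iff[OF _ A] by blast
  then show "\<exists>\<F>. finite \<F> \<and> \<F> \<subseteq> \<U> \<and> upward_closure X A \<subseteq> \<Union>\<F>" using \<F> by blast
qed

lemma upward_closure_image_upward_closure:
  assumes f: "continuous_map X Y f" and A: "A \<subseteq> topspace X"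
  shows "upward_closure Y (f ` upward_closure X A) = upward_closure Y (f ` A)"
proof
  show "upward_closure Y (f ` upward_closure X A) \<subseteq> upward_closure Y (f ` A)"
  proof
    fix z assume "z \<in> upward_closure Y (f ` upward_closure X A)"
    then obtain x y where "x \<in> A" "specializes X x y" "specializes Y (f y) z"
      by (auto simp: upward_closure_def)
    then show "z \<in> upward_closure Y (f ` A)"
      using specializes_trans[OF specializes_continuous_map[OF f]] by (auto simp: upward_closure_def)
  qed
  show "upward_closure Y (f ` A) \<subseteq> upward_closure Y (f ` upward_closure X A)"
    using image_mono[OF upward_closure_superset[OF A], of f] unfolding upward_closure_def[of Y] by blast
qed

lemma saturatedin_preimage:
  assumes f: "continuous_map X Y f" and A: "saturatedin Y A"
    and "x \<in> topspace X" "f x \<in> A" "specializes X x y"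
  shows "f y \<in> A"
  using specializes_continuous_map[OF f] assms unfolding saturatedin_def by blast

definition irreducible_subset :: "'a topology \<Rightarrow> 'a set \<Rightarrow> bool" where
  "irreducible_subset X C \<longleftrightarrow> C \<noteq> {} \<and> C \<subseteq> topspace X \<and>
     (\<forall>U V. openin X U \<longrightarrow> openin X V \<longrightarrow> U \<inter> C \<noteq> {} \<longrightarrow> V \<inter> C \<noteq> {} \<longrightarrow> U \<inter> V \<inter> C \<noteq> {})"

definition sober_space :: "'a topology \<Rightarrow> bool" where
  "sober_space X \<longleftrightarrow> t0_space X \<and>
     (\<forall>C. closedin X C \<longrightarrow> irreducible_subset X C \<longrightarrow> (\<exists>x\<in>topspace X. C = X closure_of {x}))"

section \<open>Projective systems of compact saturated sets\<close>

locale proj_system =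
  fixes I :: "'i set" and le :: "'i \<Rightarrow> 'i \<Rightarrow> bool"
    and Y :: "'i \<Rightarrow> 'b topology" and P :: "'i \<Rightarrow> 'i \<Rightarrow> 'b \<Rightarrow> 'b"
  assumes system: "projective_system I le Y P"
begin

lemma index_refl: "i \<in> I \<Longrightarrow> le i i"
  using system unfolding projective_system_def directed_preordered_def reflp_on_def by blast

lemma index_trans: "i \<in> I \<Longrightarrow> j \<in> I \<Longrightarrow> k \<in> I \<Longrightarrow> le i j \<Longrightarrow> le j k \<Longrightarrow> le i k"
  using system unfolding projective_system_def directed_preordered_def transp_on_def by blast

lemma index_nonempty: "I \<noteq> {}"
  using system unfolding projective_system_def directed_preordered_def by blast

lemma index_directed:
  assumes "i \<in> I" "j \<in> I" obtains k where "k \<in> I" "le i k" "le j k"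
  using assms system unfolding projective_system_def directed_preordered_def by blast

lemma index_directed_finite:
  assumes "finite F" "F \<subseteq> I" shows "\<exists>k\<in>I. \<forall>i\<in>F. le i k"
  using assms
proof (induction F)
  case empty
  then show ?case using index_nonempty by blast
next
  case (insert x F)
  then obtain k where k: "k \<in> I" "\<forall>i\<in>F. le i k" by auto
  obtain l where "l \<in> I" "le x l" "le k l" using index_directed[of x k] insert k by auto
  then show ?case using k insert.prems index_trans by (intro bexI[of _ l]) blast+
qed

lemma bond_continuous: "i \<in> I \<Longrightarrow> j \<in> I \<Longrightarrow> le i j \<Longrightarrow> continuous_map (Y j) (Y i) (P i j)"
  using system unfolding projective_system_def by blast

lemma bond_in_topspace:
  "i \<in> I \<Longrightarrow> j \<in> I \<Longrightarrow> le i j \<Longrightarrow> y \<in> topspace (Y j) \<Longrightarrow> P i j y \<in> topspace (Y i)"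
  using bond_continuous unfolding continuous_map_def by blast

lemma bond_id: "i \<in> I \<Longrightarrow> y \<in> topspace (Y i) \<Longrightarrow> P i i y = y"
  using system unfolding projective_system_def by blast

lemma bond_comp:
  "i \<in> I \<Longrightarrow> j \<in> I \<Longrightarrow> k \<in> I \<Longrightarrow> le i j \<Longrightarrow> le j k \<Longrightarrow> y \<in> topspace (Y k) \<Longrightarrow> P i j (P j k y) = P i k y"
  using system unfolding projective_system_def by blast

lemma topspace_limit:
  "topspace (projective_limit I le Y P) =
     {x \<in> extensional I. (\<forall>i\<in>I. x i \<in> topspace (Y i)) \<and> (\<forall>i\<in>I. \<forall>j\<in>I. le i j \<longrightarrow> P i j (x j) = x i)}"
  unfolding projective_limit_def topspace_subtopology topspace_product_topology
  by (auto simp: PiE_iff extensional_def)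

text \<open>A basic open set of the product constrains finitely many coordinates. On threads
  these constraints can be pulled back to one common upper index, so open cylinders over a single
  coordinate suffice.\<close>

lemma limit_basis:
  assumes W: "openin (projective_limit I le Y P) W" and x: "x \<in> W"
  obtains i V where "i \<in> I" "openin (Y i) V" "x i \<in> V"
    "\<And>z. z \<in> topspace (projective_limit I le Y P) \<Longrightarrow> z i \<in> V \<Longrightarrow> z \<in> W"
proof -
  let ?L = "projective_limit I le Y P"
  obtain T where T: "openin (product_topology Y I) T"
    "W = T \<inter> {x. \<forall>i\<in>I. \<forall>j\<in>I. le i j \<longrightarrow> P i j (x j) = x i}"
    using W unfolding projective_limit_def openin_subtopology by blast
  have "x \<in> T" using x T(2) by blast
  then obtain U where U: "finite {i \<in> I. U i \<noteq> topspace (Y i)}" "\<forall>i\<in>I. openin (Y i) (U i)"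
    "x \<in> PiE I U" "PiE I U \<subseteq> T"
    using T(1) unfolding openin_product_topology_alt by metis
  define F where "F = {i \<in> I. U i \<noteq> topspace (Y i)}"
  obtain k where k: "k \<in> I" "\<forall>i\<in>F. le i k"
    using index_directed_finite[of F] U(1) F_def by auto
  define V where "V = topspace (Y k) \<inter> (\<Inter>i\<in>F. {y \<in> topspace (Y k). P i k y \<in> U i})"
  have xL: "x \<in> topspace ?L" using x openin_subset[OF W] by auto
  have "openin (Y k) {y \<in> topspace (Y k). P i k y \<in> U i}" if "i \<in> F" for i
    using openin_continuous_map_preimage[OF bond_continuous] k U(2) that F_def by blast
  then have "openin (Y k) (\<Inter>(insert (topspace (Y k)) ((\<lambda>i. {y \<in> topspace (Y k). P i k y \<in> U i}) ` F)))"
    using U(1) F_def by (intro openin_Inter) auto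
  then have 1: "openin (Y k) V" by (simp add: V_def)
  have 2: "x k \<in> V"
    using xL U(3) k F_def unfolding V_def topspace_limit PiE_iff by auto
  have "z \<in> W" if z: "z \<in> topspace ?L" "z k \<in> V" for z
  proof -
    have "z i \<in> U i" if "i \<in> I" for i
    proof (cases "i \<in> F")
      case True
      then have "P i k (z k) \<in> U i" using z V_def by auto
      then show ?thesis using z(1) True k that unfolding topspace_limit by auto
    next
      case False
      then show ?thesis using z(1) that F_def unfolding topspace_limit by auto
    qed
    then have "z \<in> T" using U(4) z(1) unfolding topspace_limit PiE_def Pi_def by auto
    then show ?thesis using z(1) T(2) unfolding topspace_limit by auto
  qed
  then show ?thesis using that 1 2 k by blast
qed

end

text \<open>The setting of the Steenrod theorem. The stronger property that \<open>Q i\<close> is the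
  upward closure of the image of \<open>Q j\<close> enters in \<open>upward_closure_threads\<close>, where a prescribed point
  of \<open>Q i\<close> has to be reached.\<close>

locale compact_system = proj_system I le Y P
  for I :: "'i set" and le :: "'i \<Rightarrow> 'i \<Rightarrow> bool"
    and Y :: "'i \<Rightarrow> 'b topology" and P :: "'i \<Rightarrow> 'i \<Rightarrow> 'b \<Rightarrow> 'b" +
  fixes Q :: "'i \<Rightarrow> 'b set"
  assumes sober: "\<And>i. i \<in> I \<Longrightarrow> sober_space (Y i)"
    and compact: "\<And>i. i \<in> I \<Longrightarrow> compactin (Y i) (Q i)"
    and saturated: "\<And>i. i \<in> I \<Longrightarrow> saturatedin (Y i) (Q i)"
    and bond_Q: "\<And>i j. i \<in> I \<Longrightarrow> j \<in> I \<Longrightarrow> le i j \<Longrightarrow> P i j ` Q j \<subseteq> Q i"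
begin

text \<open>The families over which Zorn's lemma is applied. The value off \<open>I\<close> is fixed in order that
  comparing two of them as functions be the same as comparing them on \<open>I\<close>.\<close>

definition transversal :: "('i \<Rightarrow> 'b set) \<Rightarrow> bool" where
  "transversal C \<longleftrightarrow> (\<forall>i. i \<notin> I \<longrightarrow> C i = {}) \<and>
     (\<forall>i\<in>I. closedin (Y i) (C i) \<and> C i \<inter> Q i \<noteq> {}) \<and>
     (\<forall>i\<in>I. \<forall>j\<in>I. le i j \<longrightarrow> P i j ` C j \<subseteq> C i)"

text \<open>The family generated by a family \<open>D\<close> that is only available above the index \<open>m\<close>: at \<open>k\<close>,
  take the images of \<open>D j\<close> for all common upper bounds \<open>j\<close> of \<open>m\<close> and \<open>k\<close>. In general no
  single \<open>j\<close> is above all \<open>k\<close>, so one index above \<open>m\<close> cannot serve for every \<open>k\<close>.\<close>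

definition push :: "'i \<Rightarrow> ('i \<Rightarrow> 'b set) \<Rightarrow> 'i \<Rightarrow> 'b set" where
  "push m D k = (if k \<in> I then topspace (Y k) \<inter> (\<Inter>j\<in>{j\<in>I. le m j \<and> le k j}. Y k closure_of (P k j ` D j)) else {})"

text \<open>The images of \<open>D j\<close> in \<open>Y k\<close> shrink as \<open>j\<close> grows, so their closures are a filtered family of
  closed sets meeting the compact set \<open>Q k\<close>, and the intersection still meets it.\<close>

lemma transversal_push:
  assumes m: "m \<in> I"
    and D: "\<And>j. j \<in> I \<Longrightarrow> le m j \<Longrightarrow> D j \<subseteq> topspace (Y j) \<and> D j \<inter> Q j \<noteq> {}"
    and bond_D: "\<And>j k. j \<in> I \<Longrightarrow> k \<in> I \<Longrightarrow> le m j \<Longrightarrow> le j k \<Longrightarrow> P j k ` D k \<subseteq> D j"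
  shows "transversal (push m D)"
  unfolding transversal_def
proof (intro conjI allI impI ballI)
  show "push m D i = {}" if "i \<notin> I" for i using that by (simp add: push_def)
  show "closedin (Y i) (push m D i)" if "i \<in> I" for i
  proof -
    have "{j\<in>I. le m j \<and> le i j} \<noteq> {}" using index_directed[OF m that] by blast
    then show ?thesis using that by (simp add: push_def closedin_Int closedin_INT)
  qed
  show "push m D k \<inter> Q k \<noteq> {}" if k: "k \<in> I" for k
  proof -
    let ?J = "{j\<in>I. le m j \<and> le k j}"
    have "\<exists>x\<in>Q k. \<forall>j\<in>?J. x \<in> Y k closure_of (P k j ` D j)"
    proof (rule compactin_filtered_closed[OF compact[OF k]])
      show "?J \<noteq> {}" using index_directed[OF m k] by blast
      show "closedin (Y k) (Y k closure_of (P k j ` D j))" for j by simp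
      show "\<exists>n\<in>?J. Y k closure_of (P k n ` D n) \<subseteq> Y k closure_of (P k i ` D i) \<inter> Y k closure_of (P k j ` D j)"
        if i: "i \<in> ?J" and j: "j \<in> ?J" for i j
      proof -
        obtain n where n: "n \<in> I" "le i n" "le j n" using index_directed[of i j] i j by auto
        have mn: "le m n" "le k n" using index_trans[of _ i n] n i m k by auto
        have *: "P k n ` D n \<subseteq> P k h ` D h" if "h \<in> ?J" "le h n" for h
        proof
          fix y assume "y \<in> P k n ` D n"
          then obtain z where z: "z \<in> D n" "y = P k n z" by auto
          have "z \<in> topspace (Y n)" using D n mn z by blast
          then have "y = P k h (P h n z)" using bond_comp[of k h n z] k that n z by simp
          moreover have "P h n z \<in> D h" using bond_D[of h n] that n z by blast
          ultimately show "y \<in> P k h ` D h" by blast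
        qed
        show ?thesis
          using n mn closure_of_mono[OF *[OF i n(2)]] closure_of_mono[OF *[OF j n(3)]] by blast
      qed
      show "Y k closure_of (P k j ` D j) \<inter> Q k \<noteq> {}" if j: "j \<in> ?J" for j
      proof -
        obtain z where z: "z \<in> D j" "z \<in> Q j" "z \<in> topspace (Y j)" using D j by blast
        then have "P k j z \<in> Q k" "P k j z \<in> topspace (Y k)"
          using bond_Q[of k j] bond_in_topspace[of k j z] j k by auto
        moreover from this have "P k j z \<in> Y k closure_of (P k j ` D j)"
          using z(1) by (auto simp: in_closure_of)
        ultimately show ?thesis by blast
      qed
    qed
    then show ?thesis using k saturated[OF k] by (auto simp: push_def saturatedin_def)
  qed
  show "P i k ` push m D k \<subseteq> push m D i" if ik: "i \<in> I" "k \<in> I" "le i k" for i k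
  proof
    fix y assume "y \<in> P i k ` push m D k"
    then obtain z where z: "z \<in> push m D k" "y = P i k z" by auto
    then have zk: "z \<in> topspace (Y k)" using ik by (auto simp: push_def)
    have "y \<in> Y i closure_of (P i j ` D j)" if j: "j \<in> I" "le m j" "le i j" for j
    proof -
      obtain n where n: "n \<in> I" "le j n" "le k n" using index_directed[of j k] j ik by auto
      have mn: "le m n" using index_trans[of m j n] m j n by auto
      have "z \<in> Y k closure_of (P k n ` D n)" using z n mn ik by (auto simp: push_def)
      then have "y \<in> Y i closure_of (P i k ` (P k n ` D n))"
        using continuous_map_image_closure_subset[OF bond_continuous[OF ik], of "P k n ` D n"] z(2) by blast
      moreover have "P i k ` (P k n ` D n) \<subseteq> P i j ` D j"
      proof
        fix w assume "w \<in> P i k ` (P k n ` D n)"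
        then obtain v where v: "v \<in> D n" "w = P i k (P k n v)" by auto
        have vn: "v \<in> topspace (Y n)" using D n mn v by blast
        have "w = P i j (P j n v)" using bond_comp[OF _ _ _ _ _ vn] ik n j v by simp
        moreover have "P j n v \<in> D j" using bond_D[of j n] j n v by blast
        ultimately show "w \<in> P i j ` D j" by blast
      qed
      ultimately show ?thesis using closure_of_mono by blast
    qed
    then show "y \<in> push m D i" using bond_in_topspace[OF ik zk] z(2) ik by (auto simp: push_def)
  qed
qed

lemma push_subset:
  assumes "j \<in> I" "le m j" "D j \<subseteq> E" "closedin (Y j) E"
    shows "push m D j \<subseteq> E"
proof -
  have Ej: "E \<subseteq> topspace (Y j)" using assms closedin_subset by blast
  then have "P j j ` D j \<subseteq> E" using assms bond_id by (auto simp: subset_iff)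
  then have "Y j closure_of (P j j ` D j) \<subseteq> E" using closure_of_minimal assms by blast
  then show ?thesis using assms index_refl[of j] by (auto simp: push_def)
qed

lemma push_subset_transversal:
  assumes C: "transversal C" and m: "m \<in> I" and D: "\<And>j. j \<in> I \<Longrightarrow> le m j \<Longrightarrow> D j \<subseteq> C j"
  shows "push m D k \<subseteq> C k"
proof (cases "k \<in> I")
  case True
  obtain j where j: "j \<in> I" "le m j" "le k j" using index_directed[OF m True] by blast
  have "P k j ` D j \<subseteq> P k j ` C j" using D[OF j(1,2)] by blast
  also have "\<dots> \<subseteq> C k" using C True j unfolding transversal_def by blast
  finally have "Y k closure_of (P k j ` D j) \<subseteq> C k"
    using closure_of_minimal C True unfolding transversal_def by blast
  then show ?thesis using True j by (auto simp: push_def)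
qed (simp add: push_def)

text \<open>Intersections of chains of closed sets that meet the compact set \<open>Q i\<close> still meet it,
  hence Zorn's lemma applies downwards.\<close>

lemma minimal_transversal_exists:
  assumes "transversal C0"
  obtains C where "transversal C" "C \<le> C0" "\<And>D. transversal D \<Longrightarrow> D \<le> C \<Longrightarrow> D = C"
proof -
  let ?A = "{C. transversal C \<and> C \<le> C0}"
  \<comment> \<open>Zorn's lemma for the reversed order, so that maximal elements are minimal transversals\<close>
  have "\<exists>m\<in>?A. \<forall>a\<in>?A. m \<ge> a \<longrightarrow> a = m"
  proof (rule predicate_Zorn)
    show "partial_order_on ?A (relation_of (\<ge>) ?A)"
      by (rule partial_order_on_relation_ofI) auto
    fix \<C> assume "\<C> \<in> Chains (relation_of (\<ge>) ?A)"
    then have sub: "\<C> \<subseteq> ?A" and ch: "\<And>B C. B \<in> \<C> \<Longrightarrow> C \<in> \<C> \<Longrightarrow> B \<le> C \<or> C \<le> B"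
      by (auto simp: Chains_def relation_of_def)
    show "\<exists>u\<in>?A. \<forall>a\<in>\<C>. a \<ge> u"
    proof (cases "\<C> = {}")
      case True
      then show ?thesis using assms by auto
    next
      case ne: False
      define M where "M = (\<lambda>i. \<Inter>C\<in>\<C>. C i)"
      have M_le: "M \<le> C" if "C \<in> \<C>" for C using that by (auto simp: M_def le_fun_def)
      have tr: "transversal C" if "C \<in> \<C>" for C using that sub by auto
      have empty: "C i = {}" if "C \<in> \<C>" "i \<notin> I" for C i
        using tr[OF that(1)] that unfolding transversal_def by blast
      have closed: "closedin (Y i) (C i)" "C i \<inter> Q i \<noteq> {}" if "C \<in> \<C>" "i \<in> I" for C i
        using tr[OF that(1)] that unfolding transversal_def by blast+
      have bond: "P i j ` C j \<subseteq> C i" if "C \<in> \<C>" "i \<in> I" "j \<in> I" "le i j" for C i j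
        using tr[OF that(1)] that unfolding transversal_def by blast
      have "transversal M" unfolding transversal_def
      proof (intro conjI allI impI ballI)
        show "M i = {}" if "i \<notin> I" for i
          using ne empty that by (auto simp: M_def)
        show "closedin (Y i) (M i)" if "i \<in> I" for i
          unfolding M_def using ne closed that by (intro closedin_INT) auto
        show "M i \<inter> Q i \<noteq> {}" if i: "i \<in> I" for i
        proof -
          have "\<exists>x\<in>Q i. \<forall>C\<in>\<C>. x \<in> C i"
          proof (rule compactin_filtered_closed[OF compact[OF i] ne])
            show "closedin (Y i) (C i)" "C i \<inter> Q i \<noteq> {}" if "C \<in> \<C>" for C
              using closed[OF that i] by auto
            show "\<exists>k\<in>\<C>. k i \<subseteq> B i \<inter> C i" if "B \<in> \<C>" "C \<in> \<C>" for B C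
              using ch[OF that] that by (auto simp: le_fun_def)
          qed
          then show ?thesis by (auto simp: M_def)
        qed
        show "P i j ` M j \<subseteq> M i" if "i \<in> I" "j \<in> I" "le i j" for i j
        proof
          fix y assume "y \<in> P i j ` M j"
          then obtain z where z: "z \<in> M j" "y = P i j z" by blast
          have "y \<in> C i" if "C \<in> \<C>" for C
            using bond[OF that \<open>i \<in> I\<close> \<open>j \<in> I\<close> \<open>le i j\<close>] z that by (auto simp: M_def)
          then show "y \<in> M i" by (simp add: M_def)
        qed
      qed
      moreover have "M \<le> C0"
      proof -
        obtain C where C: "C \<in> \<C>" using ne by blast
        then have "C \<le> C0" using sub by auto
        then show ?thesis using M_le[OF C] by (rule order_trans[rotated])
      qed
      ultimately show ?thesis using M_le by blast
    qed
  qed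
  then obtain C where C: "transversal C" "C \<le> C0"
      and min: "\<And>D. transversal D \<Longrightarrow> D \<le> C0 \<Longrightarrow> D \<le> C \<Longrightarrow> D = C" by auto
  show ?thesis using that[OF C] min order_trans[OF _ C(2)] by blast
qed

text \<open>If \<open>U\<close> is an open set meeting \<open>C i\<close>, then the parts of the \<open>C j\<close> that avoid \<open>U\<close> cannot
  all meet \<open>Q j\<close>, since otherwise pushing them down would give a transversal strictly below \<open>C\<close>.
  So from some index on, \<open>C j \<inter> Q j\<close> is mapped into \<open>U\<close>. Applied to two open sets and a common
  upper index, this yields a point of \<open>C i\<close> in both.\<close>

lemma minimal_transversal_irreducible:
  assumes C: "transversal C" and min: "\<And>D. transversal D \<Longrightarrow> D \<le> C \<Longrightarrow> D = C" and i: "i \<in> I"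
  shows "irreducible_subset (Y i) (C i)"
  unfolding irreducible_subset_def
proof (intro conjI allI impI)
  show "C i \<noteq> {}" "C i \<subseteq> topspace (Y i)"
    using C i closedin_subset unfolding transversal_def by blast+
  have Cj: "C j \<subseteq> topspace (Y j)" if "j \<in> I" for j
    using C that closedin_subset unfolding transversal_def by blast
  have evade: "\<exists>j\<in>I. le i j \<and> (\<forall>z\<in>C j \<inter> Q j. P i j z \<in> U)"
    if U: "openin (Y i) U" "U \<inter> C i \<noteq> {}" for U
  proof (rule ccontr)
    assume neg: "\<not> ?thesis"
    define D where "D = (\<lambda>j. {z \<in> C j. P i j z \<notin> U})"
    have "transversal (push i D)"
    proof (rule transversal_push[OF i])
      show "D j \<subseteq> topspace (Y j) \<and> D j \<inter> Q j \<noteq> {}" if "j \<in> I" "le i j" for j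
        using neg that Cj[OF that(1)] by (auto simp: D_def)
      show "P j k ` D k \<subseteq> D j" if jk: "j \<in> I" "k \<in> I" "le i j" "le j k" for j k
      proof
        fix y assume "y \<in> P j k ` D k"
        then obtain z where z: "z \<in> C k" "P i k z \<notin> U" "y = P j k z" by (auto simp: D_def)
        have "P i j y = P i k z" using bond_comp[of i j k z] Cj i jk z by auto
        moreover have "y \<in> C j" using C jk z unfolding transversal_def by blast
        ultimately show "y \<in> D j" using z by (auto simp: D_def)
      qed
    qed
    moreover have "push i D \<le> C"
      unfolding le_fun_def using push_subset_transversal[OF C i, of D] by (auto simp: D_def)
    ultimately have "push i D = C" by (rule min)
    moreover have "push i D i \<subseteq> topspace (Y i) - U"
    proof (rule push_subset[OF i index_refl[OF i]])
      show "D i \<subseteq> topspace (Y i) - U"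
        using Cj[OF i] bond_id[OF i] unfolding D_def by fastforce
      show "closedin (Y i) (topspace (Y i) - U)" using U by auto
    qed
    ultimately show False using U by auto
  qed
  fix U V assume UV: "openin (Y i) U" "openin (Y i) V" "U \<inter> C i \<noteq> {}" "V \<inter> C i \<noteq> {}"
  obtain j where j: "j \<in> I" "le i j" "\<And>z. z \<in> C j \<inter> Q j \<Longrightarrow> P i j z \<in> U" using evade UV by meson
  obtain k where k: "k \<in> I" "le i k" "\<And>z. z \<in> C k \<inter> Q k \<Longrightarrow> P i k z \<in> V" using evade UV by meson
  obtain n where n: "n \<in> I" "le j n" "le k n" using index_directed[of j k] j k by auto
  obtain z where z: "z \<in> C n" "z \<in> Q n" using C n unfolding transversal_def by blast
  have zn: "z \<in> topspace (Y n)" using Cj n z by blast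
  have "P h n z \<in> C h \<inter> Q h" if "h \<in> I" "le h n" for h
    using that n z C bond_Q unfolding transversal_def by blast
  then have "P i j (P j n z) \<in> U" "P i k (P k n z) \<in> V" using j k n by blast+
  then have "P i n z \<in> U" "P i n z \<in> V" using bond_comp[OF _ _ _ _ _ zn] i j k n by auto
  moreover have "P i n z \<in> C i"
    using C z i n index_trans[of i j n] j unfolding transversal_def by blast
  ultimately show "U \<inter> V \<inter> C i \<noteq> {}" by blast
qed

text \<open>The generic points \<open>y i\<close> of a minimal transversal are compatible because pushing the
  transversal down from \<open>j\<close> does not change it: \<open>C i\<close> is then contained in the closure of the image of
  \<open>C j\<close>, that is, in the closure of the image of \<open>y j\<close>. They lie in \<open>Q i\<close> because \<open>C i\<close> meets
  \<open>Q i\<close>, all points of \<open>C i\<close> are below \<open>y i\<close>, and \<open>Q i\<close> is saturated.\<close>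

lemma thread_in_transversal:
  assumes m: "m \<in> I"
    and D: "\<And>j. j \<in> I \<Longrightarrow> le m j \<Longrightarrow> closedin (Y j) (D j) \<and> D j \<inter> Q j \<noteq> {}"
    and bond_D: "\<And>j k. j \<in> I \<Longrightarrow> k \<in> I \<Longrightarrow> le m j \<Longrightarrow> le j k \<Longrightarrow> P j k ` D k \<subseteq> D j"
  obtains x where "x \<in> topspace (projective_limit I le Y P)"
    "\<And>i. i \<in> I \<Longrightarrow> x i \<in> Q i" "\<And>j. j \<in> I \<Longrightarrow> le m j \<Longrightarrow> x j \<in> D j"
proof -
  have "transversal (push m D)"
    by (rule transversal_push[OF m _ bond_D]) (use D closedin_subset in blast)+
  then obtain C where C: "transversal C" "C \<le> push m D"
      and min: "\<And>D'. transversal D' \<Longrightarrow> D' \<le> C \<Longrightarrow> D' = C"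
    using minimal_transversal_exists by metis
  have "\<exists>y\<in>topspace (Y i). C i = Y i closure_of {y}" if "i \<in> I" for i
    using minimal_transversal_irreducible[OF C(1) min that] sober[OF that] C(1) that
    unfolding sober_space_def transversal_def by blast
  then obtain y where y: "\<And>i. i \<in> I \<Longrightarrow> y i \<in> topspace (Y i) \<and> C i = Y i closure_of {y i}" by metis
  have Cy: "C i = {z. specializes (Y i) z (y i)}" if "i \<in> I" for i
    using y[OF that] closure_of_singleton by metis
  have yC: "y i \<in> C i" if "i \<in> I" for i
    using Cy[OF that] y[OF that] specializes_refl[of "y i" "Y i"] by simp
  have compat: "P i j (y j) = y i" if ij: "i \<in> I" "j \<in> I" "le i j" for i j
  proof (rule specializes_antisym)
    show "t0_space (Y i)" using sober[OF ij(1)] by (simp add: sober_space_def)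
    have "P i j (y j) \<in> C i" using C(1) yC[OF ij(2)] ij unfolding transversal_def by blast
    then show "specializes (Y i) (P i j (y j)) (y i)" using Cy ij by auto
    have "push j C = C"
    proof (rule min)
      show "transversal (push j C)"
        by (rule transversal_push) (use ij C(1) closedin_subset in \<open>unfold transversal_def, blast+\<close>)
      show "push j C \<le> C" unfolding le_fun_def using push_subset_transversal[OF C(1) ij(2)] by blast
    qed
    then have "y i \<in> push j C i" using yC ij by simp
    then have "y i \<in> Y i closure_of (P i j ` C j)" using ij index_refl by (auto simp: push_def)
    moreover have "P i j ` C j \<subseteq> Y i closure_of {P i j (y j)}"
    proof -
      have "P i j (y j) \<in> topspace (Y i)" using bond_in_topspace[OF ij] y[OF ij(2)] by blast
      then show ?thesis
        using Cy[OF ij(2)] closure_of_singleton[of "P i j (y j)" "Y i"]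
          specializes_continuous_map[OF bond_continuous[OF ij]] by auto
    qed
    ultimately have "y i \<in> Y i closure_of {P i j (y j)}"
      using closure_of_minimal[OF _ closedin_closure_of, of "P i j ` C j" "Y i" "{P i j (y j)}"] by blast
    moreover have "P i j (y j) \<in> topspace (Y i)" using bond_in_topspace[OF ij] y[OF ij(2)] by blast
    ultimately show "specializes (Y i) (y i) (P i j (y j))" by (simp add: closure_of_singleton)
  qed
  define x where "x = restrict y I"
  have "x \<in> topspace (projective_limit I le Y P)"
    unfolding topspace_limit using y compat by (auto simp: x_def)
  moreover have "x i \<in> Q i" if "i \<in> I" for i
  proof -
    have "C i \<inter> Q i \<noteq> {}" using C(1) that unfolding transversal_def by simp
    then obtain z where "z \<in> C i" "z \<in> Q i" by auto
    then show ?thesis using Cy[OF that] saturated[OF that] that by (auto simp: saturatedin_def x_def)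
  qed
  moreover have "x j \<in> D j" if j: "j \<in> I" "le m j" for j
  proof -
    have "push m D j \<subseteq> D j" by (rule push_subset[OF j]) (use D[OF j] in simp_all)
    moreover have "C j \<subseteq> push m D j" using C(2) by (rule le_funD)
    ultimately show ?thesis using yC[OF j(1)] j by (auto simp: x_def)
  qed
  ultimately show ?thesis using that by blast
qed

end

context proj_system
begin

text \<open>The base condition carries injectivity with it: two points with the same images under all
  \<open>q i\<close> are topologically indistinguishable, and hence equal in a T0 space.\<close>

lemma homeomorphic_map_limit_iff:
  assumes t0: "t0_space L"
    and cont: "\<And>i. i \<in> I \<Longrightarrow> continuous_map L (Y i) (q i)"
    and cone: "\<And>i j t. i \<in> I \<Longrightarrow> j \<in> I \<Longrightarrow> le i j \<Longrightarrow> t \<in> topspace L \<Longrightarrow> P i j (q j t) = q i t"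
  shows "homeomorphic_map L (projective_limit I le Y P) (\<lambda>t. \<lambda>i\<in>I. q i t) \<longleftrightarrow>
     (\<forall>x\<in>topspace (projective_limit I le Y P). \<exists>t\<in>topspace L. \<forall>i\<in>I. q i t = x i) \<and>
     (\<forall>U. openin L U \<longrightarrow> (\<forall>t\<in>U. \<exists>i\<in>I. \<exists>V. openin (Y i) V \<and> q i t \<in> V \<and>
         {s \<in> topspace L. q i s \<in> V} \<subseteq> U))"
    (is "?homeo \<longleftrightarrow> ?surj \<and> ?basis")
proof -
  let ?Z = "projective_limit I le Y P"
  define h where "h = (\<lambda>t. \<lambda>i\<in>I. q i t)"
  have hI: "h t i = q i t" if "i \<in> I" for t i using that by (simp add: h_def)
  show ?thesis
  proof
    assume ?homeo
    then have "homeomorphic_map L ?Z h" by (simp add: h_def)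
    then have h: "open_map L ?Z h" "h ` topspace L = topspace ?Z" "inj_on h (topspace L)"
      unfolding homeomorphic_eq_everything_map by auto
    have ?surj
    proof
      fix x assume "x \<in> topspace ?Z"
      then have "x \<in> h ` topspace L" using h(2) by simp
      then show "\<exists>t\<in>topspace L. \<forall>i\<in>I. q i t = x i" using hI by force
    qed
    moreover have ?basis
    proof (intro allI impI ballI)
      fix U t assume U: "openin L U" "t \<in> U"
      have UL: "U \<subseteq> topspace L" using U openin_subset by blast
      have "openin ?Z (h ` U)" "h t \<in> h ` U" using h(1) U unfolding open_map_def by auto
      then obtain i V where V: "i \<in> I" "openin (Y i) V" "h t i \<in> V"
        "\<And>z. z \<in> topspace ?Z \<Longrightarrow> z i \<in> V \<Longrightarrow> z \<in> h ` U" by (rule limit_basis) blast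
      have "s \<in> U" if "s \<in> topspace L" "q i s \<in> V" for s
      proof -
        have "h s \<in> topspace ?Z" using imageI[OF that(1), of h] h(2) by simp
        then have "h s \<in> h ` U" using V(1,4) that(2) hI by simp
        then show ?thesis using h(3) UL that(1) by (auto simp: inj_on_def)
      qed
      then show "\<exists>i\<in>I. \<exists>V. openin (Y i) V \<and> q i t \<in> V \<and> {s \<in> topspace L. q i s \<in> V} \<subseteq> U"
        using V(1-3) hI[OF V(1)] by auto
    qed
    ultimately show "?surj \<and> ?basis" ..
  next
    assume sb: "?surj \<and> ?basis"
    have hZ: "h t \<in> topspace ?Z" if "t \<in> topspace L" for t
      unfolding topspace_limit using that cont cone
      by (auto simp: h_def continuous_map_def Pi_def)
    have "homeomorphic_map L ?Z h"
    proof (rule bijective_open_imp_homeomorphic_map)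
      have "continuous_map L (product_topology Y I) h"
        unfolding continuous_map_componentwise using cont by (auto simp: h_def)
      then show "continuous_map L ?Z h"
        using hZ unfolding projective_limit_def continuous_map_in_subtopology
        by (auto simp: topspace_subtopology)
      have ex: "\<exists>t\<in>topspace L. h t = x" if x: "x \<in> topspace ?Z" for x
      proof -
        obtain t where t: "t \<in> topspace L" "\<forall>i\<in>I. q i t = x i" using sb x by meson
        have "h t i = x i" for i
          using t x unfolding topspace_limit extensional_def by (cases "i \<in> I") (auto simp: h_def)
        then show ?thesis using t by blast
      qed
      then show "h ` topspace L = topspace ?Z" using hZ by fastforce
      show "open_map L ?Z h" unfolding open_map_def
      proof (intro allI impI)
        fix U assume U: "openin L U"
        show "openin ?Z (h ` U)"
        proof (subst openin_subopen, intro ballI)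
          fix x assume "x \<in> h ` U"
          then obtain t where t: "t \<in> U" "x = h t" by blast
          then obtain i V where V: "i \<in> I" "openin (Y i) V" "q i t \<in> V" "{s \<in> topspace L. q i s \<in> V} \<subseteq> U"
            using sb U by meson
          have "continuous_map ?Z (Y i) (\<lambda>z. z i)"
            unfolding projective_limit_def using V(1)
            by (intro continuous_map_from_subtopology continuous_map_product_projection)
          then have "openin ?Z {z \<in> topspace ?Z. z i \<in> V}" using V(2) openin_continuous_map_preimage by blast
          moreover have "x \<in> {z \<in> topspace ?Z. z i \<in> V}" using t V hZ hI openin_subset[OF U] by auto
          moreover have "{z \<in> topspace ?Z. z i \<in> V} \<subseteq> h ` U" using ex V hI by fastforce
          ultimately show "\<exists>T. openin ?Z T \<and> x \<in> T \<and> T \<subseteq> h ` U" by blast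
        qed
      qed
      show "inj_on h (topspace L)"
      proof (rule inj_onI, rule ccontr)
        fix s t assume st: "s \<in> topspace L" "t \<in> topspace L" "h s = h t" "s \<noteq> t"
        then have eq: "q i s = q i t" if "i \<in> I" for i using hI[OF that] by metis
        have "t' \<in> U" if same: "openin L U" "s' \<in> U" "t' \<in> topspace L" "\<And>i. i \<in> I \<Longrightarrow> q i s' = q i t'" for U s' t'
        proof -
          obtain i V where "i \<in> I" "q i s' \<in> V" "{s \<in> topspace L. q i s \<in> V} \<subseteq> U"
            using sb same(1,2) by meson
          then show ?thesis using same(3) same(4)[of i] by auto
        qed
        then have "s \<in> U \<longleftrightarrow> t \<in> U" if "openin L U" for U using that st eq by metis
        then show False using t0 st unfolding t0_space_def by metis
      qed
    qed
    then show ?homeo by (simp add: h_def)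
  qed
qed

end

locale limit_cone = proj_system I le Y P
  for I :: "'i set" and le :: "'i \<Rightarrow> 'i \<Rightarrow> bool"
    and Y :: "'i \<Rightarrow> 'b topology" and P :: "'i \<Rightarrow> 'i \<Rightarrow> 'b \<Rightarrow> 'b" +
  fixes L :: "'c topology" and q :: "'i \<Rightarrow> 'c \<Rightarrow> 'b"
  assumes cont: "\<And>i. i \<in> I \<Longrightarrow> continuous_map L (Y i) (q i)"
    and cone: "\<And>i j t. i \<in> I \<Longrightarrow> j \<in> I \<Longrightarrow> le i j \<Longrightarrow> t \<in> topspace L \<Longrightarrow> P i j (q j t) = q i t"
    and surj: "\<And>x. x \<in> topspace (projective_limit I le Y P) \<Longrightarrow> \<exists>t\<in>topspace L. \<forall>i\<in>I. q i t = x i"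
    and basis: "\<And>U t. openin L U \<Longrightarrow> t \<in> U \<Longrightarrow>
      \<exists>i\<in>I. \<exists>V. openin (Y i) V \<and> q i t \<in> V \<and> {s \<in> topspace L. q i s \<in> V} \<subseteq> U"
begin

text \<open>Of two base sets, given over the indices \<open>i\<close> and \<open>j\<close>, the union is a base set over a common
  upper index. So the base sets inside \<open>U\<close> are directed and one of them contains \<open>K\<close>.\<close>

lemma compact_basis:
  assumes K: "compactin L K" and U: "openin L U" and KU: "K \<subseteq> U"
  obtains i V where "i \<in> I" "openin (Y i) V" "q i ` K \<subseteq> V" "{s \<in> topspace L. q i s \<in> V} \<subseteq> U"
proof -
  define S where "S = (\<lambda>(i, V). {s \<in> topspace L. q i s \<in> V})"
  let ?J = "{(i, V). i \<in> I \<and> openin (Y i) V \<and> S (i, V) \<subseteq> U}"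
  have "\<exists>j\<in>?J. K \<subseteq> S j"
  proof (rule compactin_directed_Union[OF K])
    show "?J \<noteq> {}" using index_nonempty openin_empty by (fastforce simp: S_def)
    show "openin L (S j)" if "j \<in> ?J" for j
      using that openin_continuous_map_preimage[OF cont] by (auto simp: S_def)
    show "K \<subseteq> (\<Union>j\<in>?J. S j)"
    proof
      fix t assume t: "t \<in> K"
      then obtain i V where iV: "i \<in> I" "openin (Y i) V" "q i t \<in> V" "{s \<in> topspace L. q i s \<in> V} \<subseteq> U"
        using basis[OF U, of t] KU by blast
      moreover have "t \<in> topspace L" using t K compactin_subset_topspace by blast
      ultimately show "t \<in> (\<Union>j\<in>?J. S j)" by (intro UN_I[of "(i, V)"]) (auto simp: S_def)
    qed
    fix a b assume a: "a \<in> ?J" and b: "b \<in> ?J"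
    obtain i V where iV: "a = (i, V)" "i \<in> I" "openin (Y i) V" "S (i, V) \<subseteq> U" using a by auto
    obtain j W where jW: "b = (j, W)" "j \<in> I" "openin (Y j) W" "S (j, W) \<subseteq> U" using b by auto
    obtain n where n: "n \<in> I" "le i n" "le j n" using index_directed[of i j] iV jW by auto
    define T where "T = {y \<in> topspace (Y n). P i n y \<in> V} \<union> {y \<in> topspace (Y n). P j n y \<in> W}"
    have "openin (Y n) T" unfolding T_def
      using openin_continuous_map_preimage[OF bond_continuous] n iV jW by blast
    moreover have "q n s \<in> topspace (Y n)" if "s \<in> topspace L" for s
      using cont[OF n(1)] that unfolding continuous_map_def by blast
    then have "S (n, T) = S a \<union> S b"
      using cone n iV jW by (auto simp: S_def T_def)
    ultimately show "\<exists>k\<in>?J. S a \<union> S b \<subseteq> S k"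
      using n iV jW by (intro bexI[of _ "(n, T)"]) auto
  qed
  then show ?thesis using that by (auto simp: S_def)
qed

end

locale compact_limit_cone = limit_cone I le Y P L q + compact_system I le Y P Q
  for I :: "'i set" and le :: "'i \<Rightarrow> 'i \<Rightarrow> bool"
    and Y :: "'i \<Rightarrow> 'b topology" and P :: "'i \<Rightarrow> 'i \<Rightarrow> 'b \<Rightarrow> 'b"
    and L :: "'c topology" and q :: "'i \<Rightarrow> 'c \<Rightarrow> 'b" and Q :: "'i \<Rightarrow> 'b set"
begin

text \<open>The candidate for the compact subset of \<open>L\<close> that corresponds to the family \<open>Q\<close>.\<close>

definition threads :: "'c set" where
  "threads = {t \<in> topspace L. \<forall>i\<in>I. q i t \<in> Q i}"

lemma thread_exists:
  assumes m: "m \<in> I"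
    and D: "\<And>j. j \<in> I \<Longrightarrow> le m j \<Longrightarrow> closedin (Y j) (D j) \<and> D j \<inter> Q j \<noteq> {}"
    and bond_D: "\<And>j k. j \<in> I \<Longrightarrow> k \<in> I \<Longrightarrow> le m j \<Longrightarrow> le j k \<Longrightarrow> P j k ` D k \<subseteq> D j"
  obtains t where "t \<in> threads" "\<And>j. j \<in> I \<Longrightarrow> le m j \<Longrightarrow> q j t \<in> D j"
proof -
  obtain x where x: "x \<in> topspace (projective_limit I le Y P)"
    "\<And>i. i \<in> I \<Longrightarrow> x i \<in> Q i" "\<And>j. j \<in> I \<Longrightarrow> le m j \<Longrightarrow> x j \<in> D j"
    by (rule thread_in_transversal[OF m D bond_D]) blast+
  obtain t where "t \<in> topspace L" "\<forall>i\<in>I. q i t = x i" using surj[OF x(1)] by blast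
  then show ?thesis using that[of t] x by (auto simp: threads_def)
qed

lemma saturatedin_threads: "saturatedin L threads"
  unfolding saturatedin_def
proof (intro conjI ballI allI impI)
  show "threads \<subseteq> topspace L" by (auto simp: threads_def)
  fix s t assume "s \<in> threads" "specializes L s t"
  then show "t \<in> threads"
    using saturatedin_preimage[OF cont saturated] by (auto simp: threads_def specializes_def)
qed

text \<open>Suppose that a cover by open sets has no finite subcover. For a finite part \<open>\<F>\<close> of it, let
  \<open>R \<F> i\<close> be the complement of the largest open subset of \<open>Y i\<close> whose preimage lies in \<open>\<Union>\<F>\<close>. These closed sets
  meet \<open>Q i\<close>, in the image of a point that \<open>\<F>\<close> misses, and they shrink as \<open>\<F>\<close> grows. So their
  intersections over all \<open>\<F>\<close> form a compatible family meeting \<open>Q i\<close>, and a thread through it is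
  not covered at all, since the sets \<open>R {U} i\<close> for varying \<open>i\<close> determine \<open>U\<close>.\<close>

lemma compactin_threads: "compactin L threads"
  unfolding compactin_def
proof (intro conjI allI impI)
  show "threads \<subseteq> topspace L" by (auto simp: threads_def)
  fix \<U> assume \<U>: "(\<forall>U\<in>\<U>. openin L U) \<and> threads \<subseteq> \<Union>\<U>"
  show "\<exists>\<F>. finite \<F> \<and> \<F> \<subseteq> \<U> \<and> threads \<subseteq> \<Union>\<F>"
  proof (rule ccontr)
    assume neg: "\<not> ?thesis"
    let ?J = "{\<F>. finite \<F> \<and> \<F> \<subseteq> \<U>}"
    define R where "R = (\<lambda>\<F> i. topspace (Y i) - \<Union>{V. openin (Y i) V \<and> {s \<in> topspace L. q i s \<in> V} \<subseteq> \<Union>\<F>})"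
    define D where "D = (\<lambda>i. \<Inter>\<F>\<in>?J. R \<F> i)"
    have R_closed: "closedin (Y i) (R \<F> i)" for \<F> i
      unfolding R_def by (intro closedin_diff closedin_topspace openin_Union) auto
    have R_mono: "R \<G> i \<subseteq> R \<F> i" if "\<F> \<subseteq> \<G>" for \<F> \<G> i
      using Union_mono[OF that] unfolding R_def by blast
    have R_meet: "R \<F> i \<inter> Q i \<noteq> {}" if "\<F> \<in> ?J" "i \<in> I" for \<F> i
    proof -
      have "\<not> threads \<subseteq> \<Union>\<F>" using neg that(1) by simp
      then obtain t where t: "t \<in> threads" "t \<notin> \<Union>\<F>" by auto
      then have "q i t \<in> Q i" "q i t \<in> topspace (Y i)"
        using that cont[of i] by (auto simp: threads_def continuous_map_def)
      moreover have "q i t \<notin> V" if "{s \<in> topspace L. q i s \<in> V} \<subseteq> \<Union>\<F>" for V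
        using that t by (auto simp: threads_def)
      ultimately show ?thesis by (auto simp: R_def)
    qed
    have D_meet: "closedin (Y i) (D i) \<and> D i \<inter> Q i \<noteq> {}" if i: "i \<in> I" for i
    proof
      show "closedin (Y i) (D i)" unfolding D_def using R_closed by (intro closedin_INT) auto
      have "\<exists>x\<in>Q i. \<forall>\<F>\<in>?J. x \<in> R \<F> i"
      proof (rule compactin_filtered_closed[OF compact[OF i]])
        show "\<exists>\<H>\<in>?J. R \<H> i \<subseteq> R \<F> i \<inter> R \<G> i" if "\<F> \<in> ?J" "\<G> \<in> ?J" for \<F> \<G>
          using that R_mono[of \<F> "\<F> \<union> \<G>" i] R_mono[of \<G> "\<F> \<union> \<G>" i]
          by (intro bexI[of _ "\<F> \<union> \<G>"]) auto
      qed (use R_closed R_meet i in auto)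
      then show "D i \<inter> Q i \<noteq> {}" by (auto simp: D_def)
    qed
    have D_bond: "P i j ` D j \<subseteq> D i" if ij: "i \<in> I" "j \<in> I" "le i j" for i j
    proof
      fix y assume "y \<in> P i j ` D j"
      then obtain z where z: "z \<in> D j" "y = P i j z" by blast
      have zj: "z \<in> topspace (Y j)" using z closedin_subset D_meet[OF ij(2)] by blast
      have "y \<in> R \<F> i" if \<F>: "\<F> \<in> ?J" for \<F>
      proof -
        have "y \<notin> V" if V: "openin (Y i) V" "{s \<in> topspace L. q i s \<in> V} \<subseteq> \<Union>\<F>" for V
        proof
          assume "y \<in> V"
          have "q j s \<in> topspace (Y j)" if "s \<in> topspace L" for s
            using cont[OF ij(2)] that unfolding continuous_map_def by blast
          then have "{s \<in> topspace L. q j s \<in> {x \<in> topspace (Y j). P i j x \<in> V}} \<subseteq> \<Union>\<F>"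
            using V(2) cone[OF ij] by auto
          then have "z \<notin> {x \<in> topspace (Y j). P i j x \<in> V}"
            using z(1) \<F> openin_continuous_map_preimage[OF bond_continuous[OF ij] V(1)]
            unfolding D_def R_def by blast
          then show False using zj z(2) \<open>y \<in> V\<close> by auto
        qed
        then show ?thesis using bond_in_topspace[OF ij zj] z(2) by (auto simp: R_def)
      qed
      then show "y \<in> D i" by (auto simp: D_def)
    qed
    obtain m where m: "m \<in> I" using index_nonempty by blast
    have "\<exists>t\<in>threads. \<forall>i\<in>I. q i t \<in> D i"
    proof -
      \<comment> \<open>\<open>thread_exists\<close> controls only the indices above \<open>m\<close>; the bonding maps do the rest.\<close>
      obtain t where t: "t \<in> threads" "\<And>j. j \<in> I \<Longrightarrow> le m j \<Longrightarrow> q j t \<in> D j"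
        using thread_exists[OF m, of D] D_meet D_bond by metis
      have "q i t \<in> D i" if i: "i \<in> I" for i
      proof -
        obtain n where n: "n \<in> I" "le m n" "le i n" using index_directed[OF m i] by blast
        have "P i n (q n t) \<in> D i" using D_bond[of i n] t(2)[of n] n i by blast
        then show ?thesis using cone[OF i n(1,3)] t(1) by (simp add: threads_def)
      qed
      then show ?thesis using t by blast
    qed
    then obtain t where t: "t \<in> threads" "\<And>i. i \<in> I \<Longrightarrow> q i t \<in> D i" by blast
    then obtain U where U: "U \<in> \<U>" "t \<in> U" "openin L U" using \<U> by blast
    then obtain i V where V: "i \<in> I" "openin (Y i) V" "q i t \<in> V" "{s \<in> topspace L. q i s \<in> V} \<subseteq> U"
      using basis by blast
    have "q i t \<in> R {U} i" using t(2)[OF V(1)] U by (auto simp: D_def)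
    then show False using V by (auto simp: R_def)
  qed
qed

lemma threads_nonempty:
  assumes "\<And>i. i \<in> I \<Longrightarrow> Q i \<noteq> {}"
  shows "threads \<noteq> {}"
proof -
  obtain m where m: "m \<in> I" using index_nonempty by blast
  have "closedin (Y j) (topspace (Y j)) \<and> topspace (Y j) \<inter> Q j \<noteq> {}" if "j \<in> I" for j
    using assms[OF that] saturated[OF that] by (auto simp: saturatedin_def)
  then obtain t where "t \<in> threads"
  proof (rule thread_exists[OF m])
    show "P j k ` topspace (Y k) \<subseteq> topspace (Y j)" if "j \<in> I" "k \<in> I" "le j k" for j k
      using bond_in_topspace[OF that] by blast
  qed
  then show ?thesis by blast
qed

text \<open>To hit \<open>y \<in> Q i\<close> from below, look for a thread in the preimages of the closure of \<open>y\<close>: they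
  meet \<open>Q j\<close> because \<open>y\<close> is above the image of a point of \<open>Q j\<close>.\<close>

lemma upward_closure_threads:
  assumes i: "i \<in> I"
    and onto: "\<And>j. j \<in> I \<Longrightarrow> le i j \<Longrightarrow> Q i \<subseteq> upward_closure (Y i) (P i j ` Q j)"
  shows "upward_closure (Y i) (q i ` threads) = Q i"
proof
  show "upward_closure (Y i) (q i ` threads) \<subseteq> Q i"
    using saturated[OF i] i by (auto simp: upward_closure_def threads_def saturatedin_def)
  show "Q i \<subseteq> upward_closure (Y i) (q i ` threads)"
  proof
    fix y assume y: "y \<in> Q i"
    have yi: "y \<in> topspace (Y i)" using y saturated[OF i] by (auto simp: saturatedin_def)
    define D where "D = (\<lambda>j. {z \<in> topspace (Y j). P i j z \<in> Y i closure_of {y}})"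
    have "closedin (Y j) (D j) \<and> D j \<inter> Q j \<noteq> {}" if j: "j \<in> I" "le i j" for j
    proof
      show "closedin (Y j) (D j)" unfolding D_def
        by (rule closedin_continuous_map_preimage[OF bond_continuous[OF i j]]) simp
      obtain z where "z \<in> Q j" "specializes (Y i) (P i j z) y"
        using onto[OF j] y by (auto simp: upward_closure_def)
      then show "D j \<inter> Q j \<noteq> {}"
        using saturated[OF j(1)] closure_of_singleton[OF yi] by (auto simp: D_def saturatedin_def)
    qed
    moreover have "P j k ` D k \<subseteq> D j" if jk: "j \<in> I" "k \<in> I" "le i j" "le j k" for j k
    proof
      fix w assume "w \<in> P j k ` D k"
      then obtain z where z: "z \<in> topspace (Y k)" "P i k z \<in> Y i closure_of {y}" "w = P j k z"
        by (auto simp: D_def)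
      then show "w \<in> D j"
        using bond_comp[OF i jk(1,2,3,4) z(1)] bond_in_topspace[OF jk(1,2,4) z(1)] by (simp add: D_def)
    qed
    ultimately obtain t where t: "t \<in> threads" "q i t \<in> D i"
      using thread_exists[OF i, of D] index_refl[OF i] i by metis
    then have "specializes (Y i) (q i t) y"
      using closure_of_singleton[OF yi] bond_id[OF i] by (auto simp: D_def)
    then show "y \<in> upward_closure (Y i) (q i ` threads)" using t(1) by (auto simp: upward_closure_def)
  qed
qed

end

section \<open>Sobriety and functoriality of valuation spaces\<close>

lemma continuous_valuationD:
  assumes "continuous_valuation X \<nu>"
  shows valuation_extensional: "\<nu> \<in> extensional {U. openin X U}"
    and valuation_empty: "\<nu> {} = 0"
    and valuation_modular: "openin X U \<Longrightarrow> openin X V \<Longrightarrow> \<nu> U + \<nu> V = \<nu> (U \<union> V) + \<nu> (U \<inter> V)"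
    and valuation_mono: "openin X U \<Longrightarrow> openin X V \<Longrightarrow> U \<subseteq> V \<Longrightarrow> \<nu> U \<le> \<nu> V"
    and valuation_directed_Union: "D \<subseteq> {U. openin X U} \<Longrightarrow> D \<noteq> {} \<Longrightarrow>
      (\<And>U V. U \<in> D \<Longrightarrow> V \<in> D \<Longrightarrow> \<exists>W\<in>D. U \<subseteq> W \<and> V \<subseteq> W) \<Longrightarrow> \<nu> (\<Union>D) = (SUP U\<in>D. \<nu> U)"
  using assms unfolding continuous_valuation_def mono_on_def by simp_all

lemma continuous_valuation_restrictI:
  assumes "\<nu> {} = 0"
    and "\<And>U V. openin X U \<Longrightarrow> openin X V \<Longrightarrow> \<nu> U + \<nu> V = \<nu> (U \<union> V) + \<nu> (U \<inter> V)"
    and "\<And>U V. openin X U \<Longrightarrow> openin X V \<Longrightarrow> U \<subseteq> V \<Longrightarrow> \<nu> U \<le> \<nu> V"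
    and "\<And>D. D \<subseteq> {U. openin X U} \<Longrightarrow> D \<noteq> {} \<Longrightarrow>
      (\<And>U V. U \<in> D \<Longrightarrow> V \<in> D \<Longrightarrow> \<exists>W\<in>D. U \<subseteq> W \<and> V \<subseteq> W) \<Longrightarrow> \<nu> (\<Union>D) = (SUP U\<in>D. \<nu> U)"
  shows "continuous_valuation X (\<lambda>U\<in>{U. openin X U}. \<nu> U)"
  unfolding continuous_valuation_def
proof (intro conjI allI impI)
  show "mono_on {U. openin X U} (\<lambda>U\<in>{U. openin X U}. \<nu> U)"
    using assms(3) by (auto simp: mono_on_def)
  fix D assume D: "D \<subseteq> {U. openin X U}" "D \<noteq> {}" "\<forall>U\<in>D. \<forall>V\<in>D. \<exists>W\<in>D. U \<subseteq> W \<and> V \<subseteq> W"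
  then have "openin X (\<Union>D)" by auto
  moreover have "(SUP U\<in>D. restrict \<nu> {U. openin X U} U) = (SUP U\<in>D. \<nu> U)"
    using D(1) by (intro SUP_cong) auto
  ultimately show "restrict \<nu> {U. openin X U} (\<Union>D) = (SUP U\<in>D. restrict \<nu> {U. openin X U} U)"
    using assms(4)[OF D(1,2)] D(3) by simp
qed (use assms(1,2) in auto)

lemma valuation_eqI:
  assumes "continuous_valuation X \<mu>" "continuous_valuation X \<nu>"
    and "\<And>U. openin X U \<Longrightarrow> \<mu> U = \<nu> U"
  shows "\<mu> = \<nu>"
  using assms by (intro extensionalityI[of _ "{U. openin X U}"]) (auto intro: valuation_extensional)

fun admissible_mass :: "valuation_kind \<Rightarrow> ennreal \<Rightarrow> bool" where
  "admissible_mass Arbitrary m \<longleftrightarrow> True"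
| "admissible_mass Subprobability m \<longleftrightarrow> m \<le> 1"
| "admissible_mass Probability m \<longleftrightarrow> m = 1"

lemma V_space_eq:
  "V_space b X = subtopology (valuation_topology X) {\<nu>. admissible_mass b (\<nu> (topspace X))}"
  by (cases b) simp_all

lemma topspace_V_space:
  "topspace (V_space b X) = {\<nu>. continuous_valuation X \<nu> \<and> admissible_mass b (\<nu> (topspace X))}"
  unfolding V_space_eq by (auto simp: topspace_valuation_topology)

lemma openin_V_space_greater:
  assumes "openin X U"
  shows "openin (V_space b X) {\<nu> \<in> topspace (V_space b X). r < \<nu> U}"
proof (cases r)
  case (real s)
  have "openin (valuation_topology X) {\<nu>. continuous_valuation X \<nu> \<and> r < \<nu> U}"
    unfolding valuation_topology_def real
    by (rule topology_generated_by_Basis) (use assms real in auto)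
  then have "openin (V_space b X)
      ({\<nu>. continuous_valuation X \<nu> \<and> r < \<nu> U} \<inter> {\<nu>. admissible_mass b (\<nu> (topspace X))})"
    unfolding V_space_eq by (auto simp: openin_subtopology)
  moreover have "{\<nu>. continuous_valuation X \<nu> \<and> r < \<nu> U} \<inter> {\<nu>. admissible_mass b (\<nu> (topspace X))}
      = {\<nu> \<in> topspace (V_space b X). r < \<nu> U}"
    by (auto simp: topspace_V_space)
  ultimately show ?thesis by simp
qed simp

lemma V_space_neighbourhood:
  assumes W: "openin (V_space b X) W" and \<nu>: "\<nu> \<in> W"
  obtains F where "finite F" "\<And>U r. (U, r) \<in> F \<Longrightarrow> openin X U \<and> r < \<nu> U"
    "\<And>\<mu>. \<mu> \<in> topspace (V_space b X) \<Longrightarrow> (\<And>U r. (U, r) \<in> F \<Longrightarrow> r < \<mu> U) \<Longrightarrow> \<mu> \<in> W"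
proof -
  let ?S = "insert {\<nu>. continuous_valuation X \<nu>}
         {{\<nu>. continuous_valuation X \<nu> \<and> ennreal r < \<nu> U} | U r. openin X U \<and> 0 \<le> r}"
  obtain T where T: "openin (valuation_topology X) T" "W = T \<inter> {\<nu>. admissible_mass b (\<nu> (topspace X))}"
    using W unfolding V_space_eq openin_subtopology by auto
  have "generate_topology_on ?S T"
    using T(1) unfolding valuation_topology_def by (rule openin_topology_generated_by)
  then have nbhd: "\<nu> \<in> T \<Longrightarrow> \<exists>F. finite F \<and> (\<forall>(U, r)\<in>F. openin X U \<and> r < \<nu> U) \<and>
       (\<forall>\<mu>. continuous_valuation X \<mu> \<longrightarrow> (\<forall>(U, r)\<in>F. r < \<mu> U) \<longrightarrow> \<mu> \<in> T)" for \<nu>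
  proof (induction arbitrary: \<nu>)
    case (Int S T)
    obtain F G where
      "finite F" "\<forall>(U, r)\<in>F. openin X U \<and> r < \<nu> U"
      "\<forall>\<mu>. continuous_valuation X \<mu> \<longrightarrow> (\<forall>(U, r)\<in>F. r < \<mu> U) \<longrightarrow> \<mu> \<in> S"
      "finite G" "\<forall>(U, r)\<in>G. openin X U \<and> r < \<nu> U"
      "\<forall>\<mu>. continuous_valuation X \<mu> \<longrightarrow> (\<forall>(U, r)\<in>G. r < \<mu> U) \<longrightarrow> \<mu> \<in> T"
      using Int.IH[of \<nu>] Int.prems by auto
    then show ?case by (intro exI[of _ "F \<union> G"]) (simp add: ball_Un)
  next
    case (UN K)
    then obtain S where S: "S \<in> K" "\<nu> \<in> S" by auto
    then obtain F where "finite F" "\<forall>(U, r)\<in>F. openin X U \<and> r < \<nu> U"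
      "\<forall>\<mu>. continuous_valuation X \<mu> \<longrightarrow> (\<forall>(U, r)\<in>F. r < \<mu> U) \<longrightarrow> \<mu> \<in> S"
      using UN.IH[of S \<nu>] by auto
    then show ?case using S(1) by (intro exI[of _ F]) auto
  next
    case (Basis S)
    then consider "S = {\<nu>. continuous_valuation X \<nu>}"
      | U r where "openin X U" "S = {\<nu>. continuous_valuation X \<nu> \<and> ennreal r < \<nu> U}" by auto
    then show ?case
    proof cases
      case 1
      then show ?thesis by (intro exI[of _ "{}"]) auto
    next
      case (2 U r)
      then show ?thesis using Basis by (intro exI[of _ "{(U, ennreal r)}"]) auto
    qed
  qed simp
  have "\<nu> \<in> T" using \<nu> T(2) by simp
  from nbhd[OF this] obtain F where F: "finite F" "\<forall>(U, r)\<in>F. openin X U \<and> r < \<nu> U"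
       "\<forall>\<mu>. continuous_valuation X \<mu> \<longrightarrow> (\<forall>(U, r)\<in>F. r < \<mu> U) \<longrightarrow> \<mu> \<in> T"
    by (elim exE conjE) (rule that)
  show ?thesis
  proof (rule that[OF F(1)])
    show "openin X U \<and> r < \<nu> U" if "(U, r) \<in> F" for U r using F(2) that by auto
    show "\<mu> \<in> W" if "\<mu> \<in> topspace (V_space b X)" "\<And>U r. (U, r) \<in> F \<Longrightarrow> r < \<mu> U" for \<mu>
      using F(3) that unfolding T(2) topspace_V_space by auto
  qed
qed

lemma specializes_V_space_iff:
  "specializes (V_space b X) \<mu> \<nu> \<longleftrightarrow>
     \<mu> \<in> topspace (V_space b X) \<and> \<nu> \<in> topspace (V_space b X) \<and> (\<forall>U. openin X U \<longrightarrow> \<mu> U \<le> \<nu> U)"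
proof (intro iffI conjI allI impI)
  assume s: "specializes (V_space b X) \<mu> \<nu>"
  then show "\<mu> \<in> topspace (V_space b X)" "\<nu> \<in> topspace (V_space b X)"
    by (auto simp: specializes_def)
  fix U assume U: "openin X U"
  show "\<mu> U \<le> \<nu> U"
  proof (rule ccontr)
    assume "\<not> \<mu> U \<le> \<nu> U"
    then have "\<mu> \<in> {\<kappa> \<in> topspace (V_space b X). \<nu> U < \<kappa> U}"
      using s by (auto simp: specializes_def)
    then have "\<nu> \<in> {\<kappa> \<in> topspace (V_space b X). \<nu> U < \<kappa> U}"
      using s openin_V_space_greater[OF U, of b "\<nu> U"] unfolding specializes_def by blast
    then show False by simp
  qed
next
  assume s: "\<mu> \<in> topspace (V_space b X) \<and> \<nu> \<in> topspace (V_space b X) \<and>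
    (\<forall>U. openin X U \<longrightarrow> \<mu> U \<le> \<nu> U)"
  have "\<nu> \<in> W" if W: "openin (V_space b X) W" "\<mu> \<in> W" for W
  proof -
    obtain F where F: "\<And>U r. (U, r) \<in> F \<Longrightarrow> openin X U \<and> r < \<mu> U"
      "\<And>\<kappa>. \<kappa> \<in> topspace (V_space b X) \<Longrightarrow> (\<And>U r. (U, r) \<in> F \<Longrightarrow> r < \<kappa> U) \<Longrightarrow> \<kappa> \<in> W"
      using V_space_neighbourhood[OF W] by metis
    show ?thesis
    proof (rule F(2))
      show "r < \<nu> U" if "(U, r) \<in> F" for U r
        using F(1)[OF that] s by (auto intro: less_le_trans)
    qed (use s in blast)
  qed
  then show "specializes (V_space b X) \<mu> \<nu>" using s by (auto simp: specializes_def)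
qed

lemma t0_space_V_space: "t0_space (V_space b X)"
  unfolding t0_space_def
proof (intro ballI impI)
  fix \<mu> \<nu> assume mn: "\<mu> \<in> topspace (V_space b X)" "\<nu> \<in> topspace (V_space b X)" "\<mu> \<noteq> \<nu>"
  then obtain U where U: "openin X U" "\<mu> U \<noteq> \<nu> U"
    using valuation_eqI[of X \<mu> \<nu>] by (auto simp: topspace_V_space)
  then consider "\<mu> U < \<nu> U" | "\<nu> U < \<mu> U" by (auto simp: neq_iff)
  then show "\<exists>W. openin (V_space b X) W \<and> (\<mu> \<notin> W) = (\<nu> \<in> W)"
  proof cases
    case 1
    then show ?thesis
      using openin_V_space_greater[OF U(1), of b "\<mu> U"] mn by (intro exI conjI) auto
  next
    case 2
    then show ?thesis
      using openin_V_space_greater[OF U(1), of b "\<nu> U"] mn by (intro exI conjI) auto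
  qed
qed

text \<open>The first two hypotheses cover the case where \<open>a\<close> or \<open>b\<close> is zero, in which there is nothing
  strictly below it.\<close>

lemma ennreal_add_le_dense:
  fixes a b c :: ennreal
  assumes "a \<le> c" "b \<le> c" and le: "\<And>r s. r < a \<Longrightarrow> s < b \<Longrightarrow> r + s \<le> c"
  shows "a + b \<le> c"
proof (cases "a = 0 \<or> b = 0")
  case False
  \<comment> \<open>\<open>x\<close> is the supremum of what is strictly below it, and this set is nonempty for positive \<open>x\<close>.\<close>
  have step: "x + s \<le> c" if "0 < x" "\<And>r. r < x \<Longrightarrow> r + s \<le> c" for x s :: ennreal
  proof -
    have "x \<le> (SUP r\<in>{..<x}. r)" by (rule dense_le) (auto intro: SUP_upper2)
    then have "x + s \<le> (SUP r\<in>{..<x}. r) + s" by (rule add_right_mono)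
    also have "\<dots> = (SUP r\<in>{..<x}. r + s)"
      using that(1) by (intro ennreal_SUP_add_left[symmetric]) auto
    also have "\<dots> \<le> c" using that(2) by (intro SUP_least) auto
    finally show ?thesis .
  qed
  have "b + a \<le> c"
  proof (rule step)
    show "0 < b" using False by (simp add: zero_less_iff_neq_zero)
    show "s + a \<le> c" if s: "s < b" for s
      using step[of a s] le[OF _ s] False by (simp add: zero_less_iff_neq_zero add.commute)
  qed
  then show ?thesis by (simp add: add.commute)
qed (use assms in auto)

text \<open>Suprema of valuations are not modular in general. Here it suffices to approximate the values on two
  open sets by one and the same member of \<open>C\<close>, and this weak form of directedness is exactly what
  irreducibility provides.\<close>

lemma continuous_valuation_SUP:
  assumes ne: "C \<noteq> {}" and C: "\<And>\<mu>. \<mu> \<in> C \<Longrightarrow> continuous_valuation X \<mu>"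
    and dir: "\<And>U V r s. openin X U \<Longrightarrow> openin X V \<Longrightarrow> r < (SUP \<mu>\<in>C. \<mu> U) \<Longrightarrow> s < (SUP \<mu>\<in>C. \<mu> V) \<Longrightarrow>
      \<exists>\<mu>\<in>C. r < \<mu> U \<and> s < \<mu> V"
  shows "continuous_valuation X (\<lambda>U\<in>{U. openin X U}. SUP \<mu>\<in>C. \<mu> U)"
proof (rule continuous_valuation_restrictI)
  let ?S = "\<lambda>U. SUP \<mu>\<in>C. \<mu> U"
  have "?S {} = (SUP \<mu>\<in>C. 0)" using valuation_empty[OF C] by (intro SUP_cong) auto
  then show "?S {} = 0" using ne by simp
  \<comment> \<open>Stated for four sets, so that it yields both inequalities of the modular law.\<close>
  have le: "?S U + ?S V \<le> ?S A + ?S B"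
    if op: "openin X U" "openin X V" and eq: "\<And>\<mu>. \<mu> \<in> C \<Longrightarrow> \<mu> U + \<mu> V = \<mu> A + \<mu> B" for U V A B
  proof -
    have bound: "\<mu> U + \<mu> V \<le> ?S A + ?S B" if "\<mu> \<in> C" for \<mu>
    proof -
      have "\<mu> W \<le> ?S W" for W using SUP_upper[OF that, of "\<lambda>\<mu>. \<mu> W"] .
      then show ?thesis using eq[OF that] by (simp add: add_mono)
    qed
    show ?thesis
    proof (rule ennreal_add_le_dense)
      have "\<mu> U \<le> ?S A + ?S B" if "\<mu> \<in> C" for \<mu>
        using bound[OF that] by (rule order_trans[rotated]) simp
      then show "?S U \<le> ?S A + ?S B" by (rule SUP_least)
      have "\<mu> V \<le> ?S A + ?S B" if "\<mu> \<in> C" for \<mu>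
        using bound[OF that] by (rule order_trans[rotated]) simp
      then show "?S V \<le> ?S A + ?S B" by (rule SUP_least)
      fix r s assume "r < ?S U" "s < ?S V"
      then obtain \<mu> where m: "\<mu> \<in> C" "r < \<mu> U" "s < \<mu> V" using dir[OF op] by blast
      then have "r + s \<le> \<mu> U + \<mu> V" by (intro add_mono) auto
      then show "r + s \<le> ?S A + ?S B" using bound[OF m(1)] by (rule order_trans)
    qed
  qed
  show "?S U + ?S V = ?S (U \<union> V) + ?S (U \<inter> V)" if "openin X U" "openin X V" for U V
  proof (rule antisym)
    show "?S U + ?S V \<le> ?S (U \<union> V) + ?S (U \<inter> V)"
      by (rule le[OF that]) (rule valuation_modular[OF C that])
    show "?S (U \<union> V) + ?S (U \<inter> V) \<le> ?S U + ?S V"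
      by (rule le) (use that valuation_modular[OF C that] in auto)
  qed
  show "?S U \<le> ?S V" if "openin X U" "openin X V" "U \<subseteq> V" for U V
    by (rule SUP_mono) (use valuation_mono[OF C that] in blast)
  show "?S (\<Union>D) = (SUP U\<in>D. ?S U)"
    if D: "D \<subseteq> {U. openin X U}" "D \<noteq> {}" "\<And>U V. U \<in> D \<Longrightarrow> V \<in> D \<Longrightarrow> \<exists>W\<in>D. U \<subseteq> W \<and> V \<subseteq> W" for D
  proof -
    have "?S (\<Union>D) = (SUP \<mu>\<in>C. SUP U\<in>D. \<mu> U)"
      using valuation_directed_Union[OF C D] by (intro SUP_cong) auto
    also have "\<dots> = (SUP U\<in>D. ?S U)" by (rule SUP_commute)
    finally show ?thesis .
  qed
qed

text \<open>Given an irreducible closed set \<open>C\<close>, the sets \<open>{\<mu>. r < \<mu> U}\<close> with \<open>r < \<nu> U\<close>, where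
  \<open>\<nu>\<close> is the pointwise supremum of \<open>C\<close>, all meet \<open>C\<close>. By irreducibility so do their finite intersections, hence every
  neighbourhood of \<open>\<nu>\<close>. Therefore \<open>\<nu> \<in> C\<close>, and \<open>C\<close> is the set of valuations below \<open>\<nu>\<close>.\<close>

lemma sober_space_V_space: "sober_space (V_space b X)"
  unfolding sober_space_def
proof (intro conjI allI impI t0_space_V_space)
  let ?V = "V_space b X"
  fix C assume cl: "closedin ?V C" and irr: "irreducible_subset ?V C"
  have ne: "C \<noteq> {}" and sub: "C \<subseteq> topspace ?V"
    using irr by (auto simp: irreducible_subset_def)
  have meet: "U \<inter> V \<inter> C \<noteq> {}"
    if "openin ?V U" "openin ?V V" "U \<inter> C \<noteq> {}" "V \<inter> C \<noteq> {}" for U V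
    using irr that unfolding irreducible_subset_def by simp
  have val: "continuous_valuation X \<mu>" "admissible_mass b (\<mu> (topspace X))" if "\<mu> \<in> C" for \<mu>
    using sub that by (auto simp: topspace_V_space)
  define \<nu> where "\<nu> = (\<lambda>U\<in>{U. openin X U}. SUP \<mu>\<in>C. \<mu> U)"
  have \<nu>_open: "\<nu> U = (SUP \<mu>\<in>C. \<mu> U)" if "openin X U" for U using that by (simp add: \<nu>_def)
  have greater_meets: "{\<mu> \<in> topspace ?V. r < \<mu> U} \<inter> C \<noteq> {}" if gt: "r < (SUP \<mu>\<in>C. \<mu> U)" for U r
  proof -
    obtain \<mu> where "\<mu> \<in> C" "r < \<mu> U" using gt by (auto simp: less_SUP_iff)
    then show ?thesis using sub by auto
  qed
  have "continuous_valuation X \<nu>" unfolding \<nu>_def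
  proof (rule continuous_valuation_SUP[OF ne val(1)])
    fix U V r s assume a: "openin X U" "openin X V" "r < (SUP \<mu>\<in>C. \<mu> U)" "s < (SUP \<mu>\<in>C. \<mu> V)"
    have "{\<mu> \<in> topspace ?V. r < \<mu> U} \<inter> {\<mu> \<in> topspace ?V. s < \<mu> V} \<inter> C \<noteq> {}"
      by (rule meet[OF openin_V_space_greater[OF a(1)] openin_V_space_greater[OF a(2)]
            greater_meets[OF a(3)] greater_meets[OF a(4)]])
    then show "\<exists>\<mu>\<in>C. r < \<mu> U \<and> s < \<mu> V" by auto
  qed
  moreover have "admissible_mass b (\<nu> (topspace X))"
  proof -
    have "\<nu> (topspace X) = (SUP \<mu>\<in>C. \<mu> (topspace X))" by (simp add: \<nu>_open)
    moreover have "(SUP \<mu>\<in>C. \<mu> (topspace X)) = 1" if "b = Probability"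
    proof -
      have "(SUP \<mu>\<in>C. \<mu> (topspace X)) = (SUP \<mu>\<in>C. 1)"
        using val(2) that by (intro SUP_cong) auto
      then show ?thesis using ne by simp
    qed
    ultimately show ?thesis using val(2) by (cases b) (auto intro: SUP_least)
  qed
  ultimately have \<nu>V: "\<nu> \<in> topspace ?V" by (simp add: topspace_V_space)
  have "\<nu> \<in> C"
  proof (rule ccontr)
    assume "\<nu> \<notin> C"
    have "openin ?V (topspace ?V - C)" using cl by auto
    moreover have "\<nu> \<in> topspace ?V - C" using \<nu>V \<open>\<nu> \<notin> C\<close> by simp
    ultimately obtain F where F: "finite F" "\<And>U r. (U, r) \<in> F \<Longrightarrow> openin X U \<and> r < \<nu> U"
      "\<And>\<mu>. \<mu> \<in> topspace ?V \<Longrightarrow> (\<And>U r. (U, r) \<in> F \<Longrightarrow> r < \<mu> U) \<Longrightarrow> \<mu> \<in> topspace ?V - C"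
      by (rule V_space_neighbourhood) blast
    have "openin ?V {\<mu> \<in> topspace ?V. \<forall>(U, r)\<in>F. r < \<mu> U} \<and>
        {\<mu> \<in> topspace ?V. \<forall>(U, r)\<in>F. r < \<mu> U} \<inter> C \<noteq> {}"
      using F(1,2)
    proof (induction F)
      case empty
      then show ?case using ne sub by auto
    next
      case (insert p F)
      obtain U r where p: "p = (U, r)" by (cases p)
      have op: "openin X U" and gt: "r < (SUP \<mu>\<in>C. \<mu> U)"
        using insert.prems[of U r] \<nu>_open by (auto simp: p)
      have eq: "{\<mu> \<in> topspace ?V. \<forall>(U, r)\<in>insert p F. r < \<mu> U} =
          {\<mu> \<in> topspace ?V. r < \<mu> U} \<inter> {\<mu> \<in> topspace ?V. \<forall>(U, r)\<in>F. r < \<mu> U}"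
        by (auto simp: p)
      have IH: "openin ?V {\<mu> \<in> topspace ?V. \<forall>(U, r)\<in>F. r < \<mu> U}"
          "{\<mu> \<in> topspace ?V. \<forall>(U, r)\<in>F. r < \<mu> U} \<inter> C \<noteq> {}"
      proof -
        have "openin X U \<and> r < \<nu> U" if "(U, r) \<in> F" for U r
          by (rule insert.prems) (use that in simp)
        from insert.IH[OF this] show
          "openin ?V {\<mu> \<in> topspace ?V. \<forall>(U, r)\<in>F. r < \<mu> U}"
          "{\<mu> \<in> topspace ?V. \<forall>(U, r)\<in>F. r < \<mu> U} \<inter> C \<noteq> {}" by simp_all
      qed
      show ?case unfolding eq
        using openin_Int[OF openin_V_space_greater[OF op, of b r] IH(1)]
          meet[OF openin_V_space_greater[OF op] IH(1) greater_meets[OF gt] IH(2)] by simp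
    qed
    then obtain \<mu> where "\<mu> \<in> C" "\<mu> \<in> topspace ?V" "\<And>U r. (U, r) \<in> F \<Longrightarrow> r < \<mu> U" by auto
    then show False using F(3)[of \<mu>] by blast
  qed
  have "C = ?V closure_of {\<nu>}"
  proof
    show "C \<subseteq> ?V closure_of {\<nu>}"
      unfolding closure_of_singleton[OF \<nu>V]
      using sub \<nu>V \<nu>_open by (auto simp: specializes_V_space_iff intro: SUP_upper)
    show "?V closure_of {\<nu>} \<subseteq> C"
      using cl \<open>\<nu> \<in> C\<close> by (simp add: closure_of_minimal)
  qed
  then show "\<exists>x\<in>topspace ?V. C = ?V closure_of {x}" using \<nu>V by blast
qed

lemma continuous_map_into_V_space:
  assumes into: "\<And>z. z \<in> topspace Z \<Longrightarrow> f z \<in> topspace (V_space b Y)"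
    and op: "\<And>U r. openin Y U \<Longrightarrow> openin Z {z \<in> topspace Z. r < f z U}"
  shows "continuous_map Z (V_space b Y) f"
proof -
  have into': "continuous_valuation Y (f z)" "admissible_mass b (f z (topspace Y))"
    if "z \<in> topspace Z" for z
    using into[OF that] by (auto simp: topspace_V_space)
  have "continuous_map Z (valuation_topology Y) f"
    unfolding valuation_topology_def
  proof (rule continuous_on_generated_topo)
    let ?S = "insert {\<nu>. continuous_valuation Y \<nu>}
         {{\<nu>. continuous_valuation Y \<nu> \<and> ennreal r < \<nu> U} | U r. openin Y U \<and> 0 \<le> r}"
    fix W assume "W \<in> ?S"
    then consider "W = {\<nu>. continuous_valuation Y \<nu>}"
      | U r where "openin Y U" "W = {\<nu>. continuous_valuation Y \<nu> \<and> ennreal r < \<nu> U}" by auto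
    then show "openin Z (f -` W \<inter> topspace Z)"
    proof cases
      case 1
      then have "f -` W \<inter> topspace Z = topspace Z" using into' by auto
      then show ?thesis by simp
    next
      case (2 U r)
      then have "f -` W \<inter> topspace Z = {z \<in> topspace Z. ennreal r < f z U}" using into' by auto
      then show ?thesis using op[OF 2(1)] by simp
    qed
  qed (use into' in auto)
  then show ?thesis
    unfolding V_space_eq continuous_map_in_subtopology using into' by auto
qed

lemma V_map_apply: "openin Y V \<Longrightarrow> V_map X Y f \<nu> V = \<nu> {x \<in> topspace X. f x \<in> V}"
  by (simp add: V_map_def)

lemma V_map_in_V_space:
  assumes f: "continuous_map X Y f" and \<nu>: "\<nu> \<in> topspace (V_space b X)"
  shows "V_map X Y f \<nu> \<in> topspace (V_space b Y)"
proof -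
  let ?p = "\<lambda>V. {x \<in> topspace X. f x \<in> V}"
  have val: "continuous_valuation X \<nu>" "admissible_mass b (\<nu> (topspace X))"
    using \<nu> by (auto simp: topspace_V_space)
  have op: "openin X (?p V)" if "openin Y V" for V
    using openin_continuous_map_preimage[OF f that] .
  have "continuous_valuation Y (V_map X Y f \<nu>)"
    unfolding V_map_def
  proof (rule continuous_valuation_restrictI)
    show "\<nu> (?p {}) = 0" using valuation_empty[OF val(1)] by simp
    show "\<nu> (?p U) + \<nu> (?p V) = \<nu> (?p (U \<union> V)) + \<nu> (?p (U \<inter> V))"
      if "openin Y U" "openin Y V" for U V
    proof -
      have "?p U \<union> ?p V = ?p (U \<union> V)" "?p U \<inter> ?p V = ?p (U \<inter> V)" by auto
      then show ?thesis using valuation_modular[OF val(1) op[OF that(1)] op[OF that(2)]] by simp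
    qed
    show "\<nu> (?p U) \<le> \<nu> (?p V)" if "openin Y U" "openin Y V" "U \<subseteq> V" for U V
      using that by (intro valuation_mono[OF val(1)] op) auto
    show "\<nu> (?p (\<Union>D)) = (SUP U\<in>D. \<nu> (?p U))"
      if D: "D \<subseteq> {U. openin Y U}" "D \<noteq> {}" "\<And>U V. U \<in> D \<Longrightarrow> V \<in> D \<Longrightarrow> \<exists>W\<in>D. U \<subseteq> W \<and> V \<subseteq> W" for D
    proof -
      have "?p (\<Union>D) = \<Union>(?p ` D)" by auto
      also have "\<nu> \<dots> = (SUP U\<in>?p ` D. \<nu> U)"
      proof (rule valuation_directed_Union[OF val(1)])
        show "?p ` D \<subseteq> {U. openin X U}" using D(1) op by auto
        show "\<exists>W\<in>?p ` D. U \<subseteq> W \<and> V \<subseteq> W" if UV: "U \<in> ?p ` D" "V \<in> ?p ` D" for U V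
        proof -
          obtain U' V' where "U' \<in> D" "U = ?p U'" "V' \<in> D" "V = ?p V'" using UV by auto
          then show ?thesis using D(3)[of U' V'] by auto
        qed
      qed (use D(2) in simp)
      finally show ?thesis by (simp add: image_image)
    qed
  qed
  moreover have "?p (topspace Y) = topspace X" using f by (auto simp: continuous_map_def Pi_def)
  then have "V_map X Y f \<nu> (topspace Y) = \<nu> (topspace X)" by (simp add: V_map_apply)
  ultimately show ?thesis using val(2) by (simp add: topspace_V_space)
qed

lemma continuous_map_V_map:
  assumes f: "continuous_map X Y f"
  shows "continuous_map (V_space b X) (V_space b Y) (V_map X Y f)"
proof (rule continuous_map_into_V_space[OF V_map_in_V_space[OF f]])
  fix U r assume U: "openin Y U"
  show "openin (V_space b X) {\<nu> \<in> topspace (V_space b X). r < V_map X Y f \<nu> U}"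
    unfolding V_map_apply[OF U]
    by (rule openin_V_space_greater[OF openin_continuous_map_preimage[OF f U]])
qed

lemma V_map_comp:
  assumes g: "continuous_map Y Z g" and f: "continuous_map X Y f"
    and h: "\<And>x. x \<in> topspace X \<Longrightarrow> g (f x) = h x"
  shows "V_map Y Z g (V_map X Y f \<nu>) = V_map X Z h \<nu>"
proof
  fix W
  show "V_map Y Z g (V_map X Y f \<nu>) W = V_map X Z h \<nu> W"
  proof (cases "openin Z W")
    case True
    have "f x \<in> topspace Y" if "x \<in> topspace X" for x
      using f that by (auto simp: continuous_map_def)
    then have "{x \<in> topspace X. f x \<in> {y \<in> topspace Y. g y \<in> W}} = {x \<in> topspace X. h x \<in> W}"
      using h by auto
    then show ?thesis
      using openin_continuous_map_preimage[OF g True] True by (simp add: V_map_apply)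
  qed (simp add: V_map_def)
qed

lemma V_map_id:
  assumes \<nu>: "\<nu> \<in> topspace (V_space b X)" and f: "\<And>x. x \<in> topspace X \<Longrightarrow> f x = x"
  shows "V_map X X f \<nu> = \<nu>"
proof
  fix U
  have "{x \<in> topspace X. f x \<in> U} = U" if "openin X U"
    using f openin_subset[OF that] by auto
  moreover have "\<nu> \<in> extensional {U. openin X U}"
    using \<nu> by (auto simp: topspace_V_space intro: valuation_extensional)
  ultimately show "V_map X X f \<nu> U = \<nu> U"
    by (auto simp: V_map_def extensional_def)
qed

definition mixture ::
  "'a topology \<Rightarrow> real \<Rightarrow> ('a set \<Rightarrow> ennreal) \<Rightarrow> ('a set \<Rightarrow> ennreal) \<Rightarrow> ('a set \<Rightarrow> ennreal)" where
  "mixture X r \<mu> \<nu> = (\<lambda>U\<in>{U. openin X U}. ennreal r * \<mu> U + ennreal (1 - r) * \<nu> U)"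

lemma mixture_apply:
  "openin X U \<Longrightarrow> mixture X r \<mu> \<nu> U = ennreal r * \<mu> U + ennreal (1 - r) * \<nu> U"
  by (simp add: mixture_def)

lemma convex_valuations_mixture:
  "convex_valuations X Q \<longleftrightarrow>
     (\<forall>\<mu>\<in>Q. \<forall>\<nu>\<in>Q. \<forall>r. 0 \<le> r \<longrightarrow> r \<le> 1 \<longrightarrow> mixture X r \<mu> \<nu> \<in> Q)"
  by (simp add: convex_valuations_def mixture_def)

lemma mixture_in_V_space:
  assumes \<mu>: "\<mu> \<in> topspace (V_space b X)" and \<nu>: "\<nu> \<in> topspace (V_space b X)"
    and r: "0 \<le> r" "r \<le> 1"
  shows "mixture X r \<mu> \<nu> \<in> topspace (V_space b X)"
proof -
  have val: "continuous_valuation X \<mu>" "continuous_valuation X \<nu>"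
    and mass: "admissible_mass b (\<mu> (topspace X))" "admissible_mass b (\<nu> (topspace X))"
    using \<mu> \<nu> by (auto simp: topspace_V_space)
  let ?m = "\<lambda>U. ennreal r * \<mu> U + ennreal (1 - r) * \<nu> U"
  have mono: "?m U \<le> ?m V" if "openin X U" "openin X V" "U \<subseteq> V" for U V
    using valuation_mono[OF val(1) that] valuation_mono[OF val(2) that]
    by (intro add_mono mult_left_mono) auto
  have "continuous_valuation X (mixture X r \<mu> \<nu>)"
    unfolding mixture_def
  proof (rule continuous_valuation_restrictI)
    show "?m {} = 0" using val by (simp add: valuation_empty)
    show "?m U + ?m V = ?m (U \<union> V) + ?m (U \<inter> V)" if "openin X U" "openin X V" for U V
    proof -
      have "?m U + ?m V = ennreal r * (\<mu> U + \<mu> V) + ennreal (1 - r) * (\<nu> U + \<nu> V)"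
        by (simp add: distrib_left ac_simps)
      also have "\<dots> = ?m (U \<union> V) + ?m (U \<inter> V)"
        unfolding valuation_modular[OF val(1) that] valuation_modular[OF val(2) that]
        by (simp add: distrib_left ac_simps)
      finally show ?thesis .
    qed
    show "?m (\<Union>D) = (SUP U\<in>D. ?m U)"
      if D: "D \<subseteq> {U. openin X U}" "D \<noteq> {}" "\<And>U V. U \<in> D \<Longrightarrow> V \<in> D \<Longrightarrow> \<exists>W\<in>D. U \<subseteq> W \<and> V \<subseteq> W" for D
    proof -
      have "?m (\<Union>D) = (SUP U\<in>D. ennreal r * \<mu> U) + (SUP U\<in>D. ennreal (1 - r) * \<nu> U)"
        using valuation_directed_Union[OF val(1) D] valuation_directed_Union[OF val(2) D]
        by (simp only: SUP_mult_left_ennreal)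
      also have "\<dots> = (SUP U\<in>D. ?m U)"
      proof (rule SUP_add_directed_ennreal[symmetric])
        fix U V assume UV: "U \<in> D" "V \<in> D"
        then obtain W where W: "W \<in> D" "U \<subseteq> W" "V \<subseteq> W" using D(3) by blast
        have op: "openin X U" "openin X V" "openin X W" using UV W D(1) by auto
        then show "\<exists>k\<in>D. ennreal r * \<mu> U + ennreal (1 - r) * \<nu> V \<le> ?m k"
          using W by (intro bexI[of _ W] add_mono mult_left_mono valuation_mono[OF val(1)]
              valuation_mono[OF val(2)]) auto
      qed
      finally show ?thesis .
    qed
  qed (rule mono)
  moreover have "admissible_mass b (mixture X r \<mu> \<nu> (topspace X))"
  proof -
    have one: "ennreal r * 1 + ennreal (1 - r) * 1 = 1"
      using r by (simp flip: ennreal_plus)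
    have "ennreal r * m + ennreal (1 - r) * n \<le> 1" if "m \<le> 1" "n \<le> 1" for m n
      using add_mono[OF mult_left_mono[OF that(1), of "ennreal r"] mult_left_mono[OF that(2), of "ennreal (1 - r)"]]
      unfolding one by simp
    then show ?thesis using mass one by (cases b) (auto simp: mixture_apply)
  qed
  ultimately show ?thesis by (simp add: topspace_V_space)
qed

lemma V_map_mixture:
  assumes f: "continuous_map X Y f"
  shows "V_map X Y f (mixture X r \<mu> \<nu>) = mixture Y r (V_map X Y f \<mu>) (V_map X Y f \<nu>)"
proof
  fix V
  show "V_map X Y f (mixture X r \<mu> \<nu>) V = mixture Y r (V_map X Y f \<mu>) (V_map X Y f \<nu>) V"
    using openin_continuous_map_preimage[OF f, of V]
    by (cases "openin Y V") (simp_all add: V_map_def mixture_def)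
qed

lemma mixture_specializes:
  assumes "specializes (V_space b X) \<mu> \<mu>'" "specializes (V_space b X) \<nu> \<nu>'" "0 \<le> r" "r \<le> 1"
  shows "specializes (V_space b X) (mixture X r \<mu> \<nu>) (mixture X r \<mu>' \<nu>')"
  using assms mixture_in_V_space[of _ b X _ r]
  by (auto simp: specializes_V_space_iff mixture_apply intro!: add_mono mult_left_mono)

section \<open>Convex compact saturated sets of valuations\<close>

lemma QV_carrierD:
  assumes "Q \<in> QV_carrier b X"
  shows QV_nonempty: "Q \<noteq> {}" and QV_convex: "convex_valuations X Q"
    and QV_compact: "compactin (V_space b X) Q" and QV_saturated: "saturatedin (V_space b X) Q"
    and QV_subset: "Q \<subseteq> topspace (V_space b X)"
  using assms by (simp_all add: QV_carrier_def saturatedin_def)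

lemma convex_upward_closure:
  assumes Q: "convex_valuations X Q" and sub: "Q \<subseteq> topspace (V_space b X)"
  shows "convex_valuations X (upward_closure (V_space b X) Q)"
  unfolding convex_valuations_mixture
proof (intro ballI allI impI)
  fix \<mu> \<nu> and r :: real
  assume m: "\<mu> \<in> upward_closure (V_space b X) Q" and n: "\<nu> \<in> upward_closure (V_space b X) Q"
    and r: "0 \<le> r" "r \<le> 1"
  obtain \<mu>' \<nu>' where mn: "\<mu>' \<in> Q" "specializes (V_space b X) \<mu>' \<mu>" "\<nu>' \<in> Q" "specializes (V_space b X) \<nu>' \<nu>"
    using m n by (auto simp: upward_closure_def)
  have "mixture X r \<mu>' \<nu>' \<in> Q" using Q mn r by (simp add: convex_valuations_mixture)
  then show "mixture X r \<mu> \<nu> \<in> upward_closure (V_space b X) Q"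
    using mixture_specializes[OF mn(2,4) r] by (auto simp: upward_closure_def)
qed

lemma convex_V_map_image:
  assumes f: "continuous_map X Y f" and Q: "convex_valuations X Q"
  shows "convex_valuations Y (V_map X Y f ` Q)"
  unfolding convex_valuations_mixture
proof (intro ballI allI impI)
  fix \<mu> \<nu> and r :: real
  assume "\<mu> \<in> V_map X Y f ` Q" "\<nu> \<in> V_map X Y f ` Q" and r: "0 \<le> r" "r \<le> 1"
  then obtain \<mu>' \<nu>' where mn: "\<mu>' \<in> Q" "\<mu> = V_map X Y f \<mu>'" "\<nu>' \<in> Q" "\<nu> = V_map X Y f \<nu>'" by blast
  have "mixture X r \<mu>' \<nu>' \<in> Q" using Q mn r by (simp add: convex_valuations_mixture)
  then show "mixture Y r \<mu> \<nu> \<in> V_map X Y f ` Q"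
    unfolding mn(2,4) V_map_mixture[OF f, symmetric] by (rule imageI)
qed

lemma V_map_image_subset:
  assumes "continuous_map X Y f" "Q \<subseteq> topspace (V_space b X)"
  shows "V_map X Y f ` Q \<subseteq> topspace (V_space b Y)"
  using V_map_in_V_space[OF assms(1)] assms(2) by blast

lemma upward_closure_in_QV_carrier:
  assumes "Q \<noteq> {}" "convex_valuations X Q" "compactin (V_space b X) Q"
  shows "upward_closure (V_space b X) Q \<in> QV_carrier b X"
proof -
  have sub: "Q \<subseteq> topspace (V_space b X)" using assms(3) by (rule compactin_subset_topspace)
  have "upward_closure (V_space b X) Q \<noteq> {}"
    using assms(1) upward_closure_superset[OF sub] by auto
  then show ?thesis
    using convex_upward_closure[OF assms(2) sub] compactin_upward_closure[OF assms(3)]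
    by (simp add: QV_carrier_def saturatedin_upward_closure)
qed

lemma QV_map_in_QV_carrier:
  assumes f: "continuous_map X Y f" and Q: "Q \<in> QV_carrier b X"
  shows "QV_map b X Y f Q \<in> QV_carrier b Y"
  unfolding QV_map_def
  using QV_nonempty[OF Q] convex_V_map_image[OF f QV_convex[OF Q]]
    image_compactin[OF QV_compact[OF Q] continuous_map_V_map[OF f]]
  by (intro upward_closure_in_QV_carrier) auto

lemma QV_map_subset_iff:
  assumes "continuous_map X Y f" "Q \<in> QV_carrier b X" "openin (V_space b Y) U"
  shows "QV_map b X Y f Q \<subseteq> U \<longleftrightarrow> V_map X Y f ` Q \<subseteq> U"
  unfolding QV_map_def
  by (rule upward_closure_subset_iff[OF assms(3) V_map_image_subset[OF assms(1) QV_subset[OF assms(2)]]])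

lemma openin_QV_space_subset:
  "openin (V_space b X) U \<Longrightarrow> openin (QV_space b X) {Q \<in> QV_carrier b X. Q \<subseteq> U}"
  unfolding QV_space_def by (rule topology_generated_by_Basis) auto

text \<open>The generating sets of the upper Vietoris topology are closed under finite intersections, so
  they are a base.\<close>

lemma QV_space_neighbourhood:
  assumes W: "openin (QV_space b X) W" and Q: "Q \<in> W"
  obtains U where "openin (V_space b X) U" "Q \<subseteq> U" "\<And>R. R \<in> QV_carrier b X \<Longrightarrow> R \<subseteq> U \<Longrightarrow> R \<in> W"
proof -
  have "generate_topology_on {{Q \<in> QV_carrier b X. Q \<subseteq> U} | U. openin (V_space b X) U} W"
    using W unfolding QV_space_def by (rule openin_topology_generated_by)
  then have nbhd: "Q \<in> W \<Longrightarrow> \<exists>U. openin (V_space b X) U \<and> Q \<subseteq> U \<and> (\<forall>R\<in>QV_carrier b X. R \<subseteq> U \<longrightarrow> R \<in> W)" for Q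
  proof (induction arbitrary: Q)
    case (Int S T)
    obtain U V where
      "openin (V_space b X) U" "Q \<subseteq> U" "\<forall>R\<in>QV_carrier b X. R \<subseteq> U \<longrightarrow> R \<in> S"
      "openin (V_space b X) V" "Q \<subseteq> V" "\<forall>R\<in>QV_carrier b X. R \<subseteq> V \<longrightarrow> R \<in> T"
      using Int.IH[of Q] Int.prems by auto
    then show ?case by (intro exI[of _ "U \<inter> V"]) auto
  next
    case (UN K)
    then obtain S where S: "S \<in> K" "Q \<in> S" by auto
    then obtain U where "openin (V_space b X) U" "Q \<subseteq> U" "\<forall>R\<in>QV_carrier b X. R \<subseteq> U \<longrightarrow> R \<in> S"
      using UN.IH[of S Q] by auto
    then show ?case using S(1) by (intro exI[of _ U]) auto
  qed auto
  from nbhd[OF Q] show ?thesis using that by auto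
qed

lemma continuous_map_QV_map:
  assumes f: "continuous_map X Y f"
  shows "continuous_map (QV_space b X) (QV_space b Y) (QV_map b X Y f)"
proof -
  have in_carrier: "QV_map b X Y f Q \<in> QV_carrier b Y" if "Q \<in> topspace (QV_space b X)" for Q
    using QV_map_in_QV_carrier[OF f] that by (simp add: topspace_QV_space)
  show ?thesis
    unfolding QV_space_def[of b Y]
  proof (rule continuous_on_generated_topo)
    fix W assume "W \<in> {{Q \<in> QV_carrier b Y. Q \<subseteq> U} | U. openin (V_space b Y) U}"
    then obtain U where U: "openin (V_space b Y) U" "W = {Q \<in> QV_carrier b Y. Q \<subseteq> U}" by auto
    let ?U = "{\<nu> \<in> topspace (V_space b X). V_map X Y f \<nu> \<in> U}"
    have "QV_map b X Y f Q \<in> W \<longleftrightarrow> Q \<subseteq> ?U" if Q: "Q \<in> QV_carrier b X" for Q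
      using QV_map_subset_iff[OF f Q U(1)] QV_map_in_QV_carrier[OF f Q] QV_subset[OF Q] U(2) by auto
    then have "QV_map b X Y f -` W \<inter> topspace (QV_space b X) = {Q \<in> QV_carrier b X. Q \<subseteq> ?U}"
      unfolding topspace_QV_space by auto
    then show "openin (QV_space b X) (QV_map b X Y f -` W \<inter> topspace (QV_space b X))"
      using openin_QV_space_subset[OF openin_continuous_map_preimage[OF continuous_map_V_map[OF f] U(1)]]
      by simp
  next
    have "\<Union>{{Q \<in> QV_carrier b Y. Q \<subseteq> U} | U. openin (V_space b Y) U} = QV_carrier b Y"
      using topspace_QV_space[of b Y] unfolding QV_space_def topology_generated_by_topspace .
    then show "QV_map b X Y f ` topspace (QV_space b X)
        \<subseteq> \<Union>{{Q \<in> QV_carrier b Y. Q \<subseteq> U} | U. openin (V_space b Y) U}"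
      using in_carrier by auto
  qed
qed

lemma QV_map_comp:
  assumes g: "continuous_map Y Z g" and f: "continuous_map X Y f"
    and h: "\<And>x. x \<in> topspace X \<Longrightarrow> g (f x) = h x"
    and Q: "Q \<in> QV_carrier b X"
  shows "QV_map b Y Z g (QV_map b X Y f Q) = QV_map b X Z h Q"
proof -
  have "QV_map b Y Z g (QV_map b X Y f Q) =
      upward_closure (V_space b Z) (V_map Y Z g ` (V_map X Y f ` Q))"
    unfolding QV_map_def
    by (rule upward_closure_image_upward_closure[OF continuous_map_V_map[OF g] V_map_image_subset[OF f QV_subset[OF Q]]])
  also have "V_map Y Z g ` (V_map X Y f ` Q) = V_map X Z h ` Q"
    unfolding image_image using V_map_comp[OF g f h] by simp
  finally show ?thesis by (simp add: QV_map_def)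
qed

lemma QV_map_id:
  assumes Q: "Q \<in> QV_carrier b X" and f: "\<And>x. x \<in> topspace X \<Longrightarrow> f x = x"
  shows "QV_map b X X f Q = Q"
proof -
  have "V_map X X f ` Q = (\<lambda>\<nu>. \<nu>) ` Q"
    using V_map_id[OF _ f] QV_subset[OF Q] by (intro image_cong) auto
  then show ?thesis
    unfolding QV_map_def using upward_closure_saturated[OF QV_saturated[OF Q]] by simp
qed

text \<open>A compact saturated set is determined by its open neighbourhoods: a valuation \<open>\<nu>\<close> outside \<open>Q\<close>
  is excluded by the complement of its closure, which contains \<open>Q\<close> by saturation.\<close>

lemma t0_space_QV_space: "t0_space (QV_space b X)"
proof -
  let ?V = "V_space b X"
  have sep: "\<exists>W. openin (QV_space b X) W \<and> Q \<in> W \<and> R \<notin> W"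
    if Q: "Q \<in> QV_carrier b X" and \<nu>: "\<nu> \<in> R" "\<nu> \<notin> Q" "\<nu> \<in> topspace ?V" for Q R \<nu>
  proof -
    let ?U = "topspace ?V - ?V closure_of {\<nu>}"
    have "openin ?V ?U" by (simp add: openin_diff)
    moreover have "Q \<subseteq> ?U"
    proof
      fix \<mu> assume m: "\<mu> \<in> Q"
      have "\<not> specializes ?V \<mu> \<nu>" using QV_saturated[OF Q] m \<nu>(2) by (auto simp: saturatedin_def)
      then show "\<mu> \<in> ?U" using m QV_subset[OF Q] closure_of_singleton[OF \<nu>(3)] by auto
    qed
    moreover have "\<not> R \<subseteq> ?U"
      using \<nu> closure_of_singleton[OF \<nu>(3)] specializes_refl[OF \<nu>(3)] by auto
    ultimately show ?thesis using openin_QV_space_subset[of b X ?U] Q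
      by (intro exI[of _ "{Q \<in> QV_carrier b X. Q \<subseteq> ?U}"]) simp
  qed
  show ?thesis unfolding t0_space_def topspace_QV_space
  proof (intro ballI impI)
    fix Q R assume QR: "Q \<in> QV_carrier b X" "R \<in> QV_carrier b X" "Q \<noteq> R"
    then consider \<nu> where "\<nu> \<in> R" "\<nu> \<notin> Q" | \<nu> where "\<nu> \<in> Q" "\<nu> \<notin> R" by auto
    then show "\<exists>U. openin (QV_space b X) U \<and> (Q \<notin> U) = (R \<in> U)"
    proof cases
      case 1
      then show ?thesis using sep[OF QR(1), of \<nu> R] QV_subset[OF QR(2)] by auto
    next
      case 2
      then show ?thesis using sep[OF QR(2), of \<nu> Q] QV_subset[OF QR(1)] by auto
    qed
  qed
qed

text \<open>The unit \<open>\<nu> \<mapsto> \<up>\<nu>\<close> of the upper powerspace construction. It is natural and a topological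
  embedding; the lemmas below give these facts.\<close>

definition principal_upset :: "valuation_kind \<Rightarrow> 'a topology \<Rightarrow> ('a set \<Rightarrow> ennreal) \<Rightarrow> ('a set \<Rightarrow> ennreal) set" where
  "principal_upset b X \<nu> = upward_closure (V_space b X) {\<nu>}"

lemma principal_upset_iff: "\<mu> \<in> principal_upset b X \<nu> \<longleftrightarrow> specializes (V_space b X) \<nu> \<mu>"
  by (simp add: principal_upset_def upward_closure_def)

lemma convex_singleton:
  assumes \<nu>: "\<nu> \<in> topspace (V_space b X)" shows "convex_valuations X {\<nu>}"
proof -
  have "mixture X r \<nu> \<nu> = \<nu>" if r: "0 \<le> r" "r \<le> 1" for r
  proof (rule valuation_eqI[of X])
    show "continuous_valuation X (mixture X r \<nu> \<nu>)" "continuous_valuation X \<nu>"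
      using mixture_in_V_space[OF \<nu> \<nu> r] \<nu> by (auto simp: topspace_V_space)
    have "ennreal r + ennreal (1 - r) = 1" using r by (simp flip: ennreal_plus)
    then show "mixture X r \<nu> \<nu> U = \<nu> U" if "openin X U" for U
      using that by (simp add: mixture_apply flip: distrib_right)
  qed
  then show ?thesis by (simp add: convex_valuations_mixture)
qed

lemma principal_upset_in_QV_carrier:
  "\<nu> \<in> topspace (V_space b X) \<Longrightarrow> principal_upset b X \<nu> \<in> QV_carrier b X"
  unfolding principal_upset_def by (intro upward_closure_in_QV_carrier convex_singleton) simp_all

lemma principal_upset_subset_iff:
  assumes "openin (V_space b X) U" "\<nu> \<in> topspace (V_space b X)"
  shows "principal_upset b X \<nu> \<subseteq> U \<longleftrightarrow> \<nu> \<in> U"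
  unfolding principal_upset_def using upward_closure_subset_iff[OF assms(1), of "{\<nu>}"] assms(2) by simp

lemma QV_map_principal_upset:
  assumes "continuous_map X Y f" "\<nu> \<in> topspace (V_space b X)"
  shows "QV_map b X Y f (principal_upset b X \<nu>) = principal_upset b Y (V_map X Y f \<nu>)"
  unfolding QV_map_def principal_upset_def
  using upward_closure_image_upward_closure[OF continuous_map_V_map[OF assms(1)], of "{\<nu>}" b] assms(2) by simp

lemma openin_principal_upset_preimage:
  assumes W: "openin (QV_space b X) W"
  shows "openin (V_space b X) {\<nu> \<in> topspace (V_space b X). principal_upset b X \<nu> \<in> W}"
proof (subst openin_subopen, intro ballI)
  fix \<nu> assume "\<nu> \<in> {\<nu> \<in> topspace (V_space b X). principal_upset b X \<nu> \<in> W}"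
  then have \<nu>: "\<nu> \<in> topspace (V_space b X)" "principal_upset b X \<nu> \<in> W" by auto
  obtain U where U: "openin (V_space b X) U" "principal_upset b X \<nu> \<subseteq> U"
      "\<And>R. R \<in> QV_carrier b X \<Longrightarrow> R \<subseteq> U \<Longrightarrow> R \<in> W"
    using QV_space_neighbourhood[OF W \<nu>(2)] by metis
  have "U \<subseteq> {\<nu> \<in> topspace (V_space b X). principal_upset b X \<nu> \<in> W}"
  proof
    fix \<mu> assume "\<mu> \<in> U"
    moreover from this have m: "\<mu> \<in> topspace (V_space b X)" using openin_subset[OF U(1)] by auto
    ultimately have "principal_upset b X \<mu> \<subseteq> U" using principal_upset_subset_iff[OF U(1)] by simp
    then show "\<mu> \<in> {\<nu> \<in> topspace (V_space b X). principal_upset b X \<nu> \<in> W}"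
      using U(3)[OF principal_upset_in_QV_carrier[OF m]] m by simp
  qed
  moreover have "\<nu> \<in> U" using principal_upset_subset_iff[OF U(1) \<nu>(1)] U(2) by simp
  ultimately show "\<exists>T. openin (V_space b X) T \<and> \<nu> \<in> T \<and> T \<subseteq> {\<nu> \<in> topspace (V_space b X). principal_upset b X \<nu> \<in> W}"
    using U(1) by blast
qed

section \<open>Transfer of limit preservation\<close>

lemma projective_system_V:
  assumes "projective_system I le X p"
  shows "projective_system I le (\<lambda>i. V_space b (X i)) (\<lambda>i j. V_map (X j) (X i) (p i j))"
proof -
  interpret proj_system I le X p by unfold_locales fact
  show ?thesis
    unfolding projective_system_def
  proof (intro conjI ballI impI)
    show "directed_preordered I le" using assms by (simp add: projective_system_def)
    show "continuous_map (V_space b (X j)) (V_space b (X i)) (V_map (X j) (X i) (p i j))"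
      if "i \<in> I" "j \<in> I" "le i j" for i j
      using continuous_map_V_map[OF bond_continuous[OF that]] .
    show "V_map (X i) (X i) (p i i) \<nu> = \<nu>" if "i \<in> I" "\<nu> \<in> topspace (V_space b (X i))" for i \<nu>
      using V_map_id[OF that(2) bond_id[OF that(1)]] .
    show "V_map (X j) (X i) (p i j) (V_map (X k) (X j) (p j k) \<nu>) = V_map (X k) (X i) (p i k) \<nu>"
      if "i \<in> I" "j \<in> I" "k \<in> I" "le i j" "le j k" for i j k \<nu>
      by (rule V_map_comp[OF bond_continuous bond_continuous bond_comp]) (use that in simp_all)
  qed
qed

lemma projective_system_QV:
  assumes "projective_system I le X p"
  shows "projective_system I le (\<lambda>i. QV_space b (X i)) (\<lambda>i j. QV_map b (X j) (X i) (p i j))"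
proof -
  interpret proj_system I le X p by unfold_locales fact
  show ?thesis
    unfolding projective_system_def topspace_QV_space
  proof (intro conjI ballI impI)
    show "directed_preordered I le" using assms by (simp add: projective_system_def)
    show "continuous_map (QV_space b (X j)) (QV_space b (X i)) (QV_map b (X j) (X i) (p i j))"
      if "i \<in> I" "j \<in> I" "le i j" for i j
      using continuous_map_QV_map[OF bond_continuous[OF that]] .
    show "QV_map b (X i) (X i) (p i i) Q = Q" if "i \<in> I" "Q \<in> QV_carrier b (X i)" for i Q
      using QV_map_id[OF that(2) bond_id[OF that(1)]] .
    show "QV_map b (X j) (X i) (p i j) (QV_map b (X k) (X j) (p j k) Q) = QV_map b (X k) (X i) (p i k) Q"
      if "i \<in> I" "j \<in> I" "k \<in> I" "le i j" "le j k" "Q \<in> QV_carrier b (X k)" for i j k Q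
      by (rule QV_map_comp[OF bond_continuous bond_continuous bond_comp]) (use that in simp_all)
  qed
qed

context
  fixes b :: valuation_kind
    and I :: "'i set" and le :: "'i \<Rightarrow> 'i \<Rightarrow> bool"
    and X :: "'i \<Rightarrow> 'a topology" and p :: "'i \<Rightarrow> 'i \<Rightarrow> 'a \<Rightarrow> 'a"
  assumes sys: "projective_system I le X p"
begin

interpretation X: proj_system I le X p
  by unfold_locales (rule sys)

interpretation V: proj_system I le "\<lambda>i. V_space b (X i)" "\<lambda>i j. V_map (X j) (X i) (p i j)"
  by unfold_locales (rule projective_system_V[OF sys])

interpretation QV: proj_system I le "\<lambda>i. QV_space b (X i)" "\<lambda>i j. QV_map b (X j) (X i) (p i j)"
  by unfold_locales (rule projective_system_QV[OF sys])

abbreviation (input) lim where "lim \<equiv> projective_limit I le X p"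
abbreviation (input) Vpr where "Vpr i \<equiv> V_map lim (X i) (\<lambda>x. x i)"
abbreviation (input) QVpr where "QVpr i \<equiv> QV_map b lim (X i) (\<lambda>x. x i)"
abbreviation (input) limV where
  "limV \<equiv> projective_limit I le (\<lambda>i. V_space b (X i)) (\<lambda>i j. V_map (X j) (X i) (p i j))"
abbreviation (input) limQV where
  "limQV \<equiv> projective_limit I le (\<lambda>i. QV_space b (X i)) (\<lambda>i j. QV_map b (X j) (X i) (p i j))"

lemma continuous_map_projection: "i \<in> I \<Longrightarrow> continuous_map lim (X i) (\<lambda>x. x i)"
  unfolding projective_limit_def
  by (intro continuous_map_from_subtopology continuous_map_product_projection)

lemma bond_projection:
  "i \<in> I \<Longrightarrow> j \<in> I \<Longrightarrow> le i j \<Longrightarrow> x \<in> topspace lim \<Longrightarrow> p i j (x j) = x i"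
  unfolding X.topspace_limit by simp

lemma V_cone:
  "i \<in> I \<Longrightarrow> j \<in> I \<Longrightarrow> le i j \<Longrightarrow> V_map (X j) (X i) (p i j) (Vpr j \<nu>) = Vpr i \<nu>"
  by (rule V_map_comp[OF X.bond_continuous continuous_map_projection bond_projection]) simp_all

lemma QV_cone:
  "i \<in> I \<Longrightarrow> j \<in> I \<Longrightarrow> le i j \<Longrightarrow> Q \<in> QV_carrier b lim \<Longrightarrow>
     QV_map b (X j) (X i) (p i j) (QVpr j Q) = QVpr i Q"
  by (rule QV_map_comp[OF X.bond_continuous continuous_map_projection bond_projection]) simp_all

lemma V_preserves_limit_iff:
  "V_preserves_limit b I le X p \<longleftrightarrow>
     (\<forall>x\<in>topspace limV. \<exists>\<nu>\<in>topspace (V_space b lim). \<forall>i\<in>I. Vpr i \<nu> = x i) \<and>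
     (\<forall>U. openin (V_space b lim) U \<longrightarrow> (\<forall>\<nu>\<in>U. \<exists>i\<in>I. \<exists>V. openin (V_space b (X i)) V \<and> Vpr i \<nu> \<in> V \<and>
         {\<mu> \<in> topspace (V_space b lim). Vpr i \<mu> \<in> V} \<subseteq> U))"
  unfolding V_preserves_limit_def limit_preserved_def Let_def
  by (rule V.homeomorphic_map_limit_iff[OF t0_space_V_space continuous_map_V_map[OF continuous_map_projection] V_cone])

lemma QV_preserves_limit_iff:
  "QV_preserves_limit b I le X p \<longleftrightarrow>
     (\<forall>x\<in>topspace limQV. \<exists>Q\<in>topspace (QV_space b lim). \<forall>i\<in>I. QVpr i Q = x i) \<and>
     (\<forall>U. openin (QV_space b lim) U \<longrightarrow> (\<forall>Q\<in>U. \<exists>i\<in>I. \<exists>V. openin (QV_space b (X i)) V \<and> QVpr i Q \<in> V \<and>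
         {R \<in> topspace (QV_space b lim). QVpr i R \<in> V} \<subseteq> U))"
  unfolding QV_preserves_limit_def limit_preserved_def Let_def
  by (rule QV.homeomorphic_map_limit_iff[OF t0_space_QV_space continuous_map_QV_map[OF continuous_map_projection] QV_cone])
    (simp_all add: topspace_QV_space)

text \<open>\<open>C i\<close> in the proof is the closed set of valuations on the limit whose image is below \<open>x i\<close>. Compactness of
  \<open>Q\<close> produces one element lying in all \<open>C i\<close> at once.\<close>

lemma V_preserves_limit_if_QV_preserves_limit:
  assumes "QV_preserves_limit b I le X p"
  shows "V_preserves_limit b I le X p"
proof -
  have surj: "\<And>x. x \<in> topspace limQV \<Longrightarrow> \<exists>Q\<in>QV_carrier b lim. \<forall>i\<in>I. QVpr i Q = x i"
    and basis: "\<And>U Q. openin (QV_space b lim) U \<Longrightarrow> Q \<in> U \<Longrightarrow>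
      \<exists>i\<in>I. \<exists>V. openin (QV_space b (X i)) V \<and> QVpr i Q \<in> V \<and> {R \<in> QV_carrier b lim. QVpr i R \<in> V} \<subseteq> U"
    using assms unfolding QV_preserves_limit_iff topspace_QV_space by simp_all
  have "\<exists>\<nu>\<in>topspace (V_space b lim). \<forall>i\<in>I. Vpr i \<nu> = x i" if x: "x \<in> topspace limV" for x
  proof -
    have xV: "x i \<in> topspace (V_space b (X i))" if "i \<in> I" for i
      using x that unfolding V.topspace_limit by simp
    have xbond: "V_map (X j) (X i) (p i j) (x j) = x i" if "i \<in> I" "j \<in> I" "le i j" for i j
      using x that unfolding V.topspace_limit by simp
    define z where "z = (\<lambda>i\<in>I. principal_upset b (X i) (x i))"
    have "z \<in> topspace limQV"
      unfolding QV.topspace_limit topspace_QV_space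
      using xbond principal_upset_in_QV_carrier[OF xV] QV_map_principal_upset[OF X.bond_continuous xV]
      by (simp add: z_def)
    from surj[OF this] obtain Q where Q: "Q \<in> QV_carrier b lim" "\<And>i. i \<in> I \<Longrightarrow> QVpr i Q = principal_upset b (X i) (x i)"
      by (auto simp: z_def)
    define C where "C = (\<lambda>i. {\<nu> \<in> topspace (V_space b lim). Vpr i \<nu> \<in> V_space b (X i) closure_of {x i}})"
    have C_iff: "\<nu> \<in> C i \<longleftrightarrow> \<nu> \<in> topspace (V_space b lim) \<and> specializes (V_space b (X i)) (Vpr i \<nu>) (x i)"
      if "i \<in> I" for i \<nu>
      using closure_of_singleton[OF xV[OF that]] by (simp add: C_def)
    have "\<exists>\<nu>\<in>Q. \<forall>i\<in>I. \<nu> \<in> C i"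
    proof (rule compactin_filtered_closed[OF QV_compact[OF Q(1)] X.index_nonempty])
      show "closedin (V_space b lim) (C i)" if "i \<in> I" for i
        unfolding C_def
        by (rule closedin_continuous_map_preimage[OF continuous_map_V_map[OF continuous_map_projection[OF that]]]) simp
      show "\<exists>k\<in>I. C k \<subseteq> C i \<inter> C j" if ij: "i \<in> I" "j \<in> I" for i j
      proof -
        obtain k where k: "k \<in> I" "le i k" "le j k" using X.index_directed[OF ij] .
        have "C k \<subseteq> C h" if h: "h \<in> I" "le h k" for h
        proof
          fix \<nu> assume "\<nu> \<in> C k"
          then have \<nu>: "\<nu> \<in> topspace (V_space b lim)" "specializes (V_space b (X k)) (Vpr k \<nu>) (x k)"
            using C_iff[OF k(1)] by auto
          have "specializes (V_space b (X h)) (V_map (X k) (X h) (p h k) (Vpr k \<nu>)) (V_map (X k) (X h) (p h k) (x k))"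
            by (rule specializes_continuous_map[OF V.bond_continuous[OF h(1) k(1) h(2)] \<nu>(2)])
          then show "\<nu> \<in> C h" using C_iff[OF h(1)] \<nu>(1) V_cone[OF h(1) k(1) h(2)] xbond[OF h(1) k(1) h(2)] by simp
        qed
        then show ?thesis using k ij by blast
      qed
      show "C i \<inter> Q \<noteq> {}" if i: "i \<in> I" for i
      proof -
        have "x i \<in> QVpr i Q" using Q(2)[OF i] specializes_refl[OF xV[OF i]] by (simp add: principal_upset_iff)
        then obtain \<nu> where "\<nu> \<in> Q" "specializes (V_space b (X i)) (Vpr i \<nu>) (x i)"
          by (auto simp: QV_map_def upward_closure_def)
        then show ?thesis using C_iff[OF i] QV_subset[OF Q(1)] by auto
      qed
    qed
    then obtain \<nu> where \<nu>: "\<nu> \<in> Q" "\<And>i. i \<in> I \<Longrightarrow> \<nu> \<in> C i" by auto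
    have \<nu>V: "\<nu> \<in> topspace (V_space b lim)" using \<nu>(1) QV_subset[OF Q(1)] by auto
    have "Vpr i \<nu> = x i" if i: "i \<in> I" for i
    proof (rule specializes_antisym[OF t0_space_V_space])
      show "specializes (V_space b (X i)) (Vpr i \<nu>) (x i)" using \<nu>(2)[OF i] C_iff[OF i] by simp
      have "Vpr i ` Q \<subseteq> QVpr i Q"
        unfolding QV_map_def
        by (rule upward_closure_superset[OF V_map_image_subset[OF continuous_map_projection[OF i] QV_subset[OF Q(1)]]])
      then have "Vpr i \<nu> \<in> principal_upset b (X i) (x i)" using \<nu>(1) Q(2)[OF i] by auto
      then show "specializes (V_space b (X i)) (x i) (Vpr i \<nu>)" by (simp add: principal_upset_iff)
    qed
    then show ?thesis using \<nu>V by blast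
  qed
  moreover have "\<exists>i\<in>I. \<exists>V. openin (V_space b (X i)) V \<and> Vpr i \<nu> \<in> V \<and>
         {\<mu> \<in> topspace (V_space b lim). Vpr i \<mu> \<in> V} \<subseteq> U"
    if U: "openin (V_space b lim) U" "\<nu> \<in> U" for U \<nu>
  proof -
    have \<nu>: "\<nu> \<in> topspace (V_space b lim)" using U openin_subset by blast
    have "principal_upset b lim \<nu> \<in> {Q \<in> QV_carrier b lim. Q \<subseteq> U}"
      using principal_upset_in_QV_carrier[OF \<nu>] principal_upset_subset_iff[OF U(1) \<nu>] U(2) by simp
    from basis[OF openin_QV_space_subset[OF U(1)] this]
    obtain i W where W: "i \<in> I" "openin (QV_space b (X i)) W" "QVpr i (principal_upset b lim \<nu>) \<in> W"
      "{R \<in> QV_carrier b lim. QVpr i R \<in> W} \<subseteq> {Q \<in> QV_carrier b lim. Q \<subseteq> U}" by auto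
    note pr = continuous_map_projection[OF W(1)]
    let ?V = "{\<kappa> \<in> topspace (V_space b (X i)). principal_upset b (X i) \<kappa> \<in> W}"
    have "\<mu> \<in> U" if \<mu>: "\<mu> \<in> topspace (V_space b lim)" "Vpr i \<mu> \<in> ?V" for \<mu>
    proof -
      have "QVpr i (principal_upset b lim \<mu>) \<in> W" using \<mu>(2) QV_map_principal_upset[OF pr \<mu>(1)] by simp
      then have "principal_upset b lim \<mu> \<subseteq> U" using W(4) principal_upset_in_QV_carrier[OF \<mu>(1)] by auto
      then show ?thesis using principal_upset_subset_iff[OF U(1) \<mu>(1)] by simp
    qed
    moreover have "Vpr i \<nu> \<in> ?V"
      using V_map_in_V_space[OF pr \<nu>] W(3) QV_map_principal_upset[OF pr \<nu>] by simp
    ultimately show ?thesis using W(1) openin_principal_upset_preimage[OF W(2)] by blast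
  qed
  ultimately show ?thesis unfolding V_preserves_limit_iff by simp
qed

text \<open>The compact set over a given thread \<open>Q'\<close> is \<open>threads\<close>; only its convexity remains to be checked
  here, the topological properties come from the sobriety of the valuation spaces.\<close>

lemma QV_preserves_limit_if_V_preserves_limit:
  assumes "V_preserves_limit b I le X p"
  shows "QV_preserves_limit b I le X p"
proof -
  interpret cone: limit_cone I le "\<lambda>i. V_space b (X i)" "\<lambda>i j. V_map (X j) (X i) (p i j)" "V_space b lim" Vpr
    using assms continuous_map_V_map[OF continuous_map_projection] V_cone
    unfolding V_preserves_limit_iff by unfold_locales simp_all
  have "\<exists>Q\<in>QV_carrier b lim. \<forall>i\<in>I. QVpr i Q = Q' i" if Q': "Q' \<in> topspace limQV" for Q'
  proof -
    have car: "Q' i \<in> QV_carrier b (X i)" if "i \<in> I" for i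
      using Q' that unfolding QV.topspace_limit topspace_QV_space by simp
    have bond: "QV_map b (X j) (X i) (p i j) (Q' j) = Q' i" if "i \<in> I" "j \<in> I" "le i j" for i j
      using Q' that unfolding QV.topspace_limit by simp
    interpret compact_limit_cone I le "\<lambda>i. V_space b (X i)" "\<lambda>i j. V_map (X j) (X i) (p i j)"
      "V_space b lim" Vpr Q'
    proof unfold_locales
      show "sober_space (V_space b (X i))" for i by (rule sober_space_V_space)
      show "compactin (V_space b (X i)) (Q' i)" "saturatedin (V_space b (X i)) (Q' i)" if "i \<in> I" for i
        using car[OF that] by (rule QV_compact, rule QV_saturated)
      show "V_map (X j) (X i) (p i j) ` Q' j \<subseteq> Q' i" if ij: "i \<in> I" "j \<in> I" "le i j" for i j
        using upward_closure_superset[OF V_map_image_subset[OF X.bond_continuous[OF ij] QV_subset[OF car[OF ij(2)]]]]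
          bond[OF ij] by (simp add: QV_map_def)
    qed
    have "convex_valuations lim threads"
      unfolding convex_valuations_mixture
    proof (intro ballI allI impI)
      fix \<mu> \<nu> and r :: real assume a: "\<mu> \<in> threads" "\<nu> \<in> threads" "0 \<le> r" "r \<le> 1"
      have "Vpr i (mixture lim r \<mu> \<nu>) \<in> Q' i" if i: "i \<in> I" for i
        using QV_convex[OF car[OF i]] a i V_map_mixture[OF continuous_map_projection[OF i]]
        by (simp add: convex_valuations_mixture threads_def)
      then show "mixture lim r \<mu> \<nu> \<in> threads"
        using mixture_in_V_space[of \<mu> b lim \<nu> r] a by (simp add: threads_def)
    qed
    then have "threads \<in> QV_carrier b lim"
      using threads_nonempty QV_nonempty[OF car] compactin_threads saturatedin_threads
      by (simp add: QV_carrier_def)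
    moreover have "QVpr i threads = Q' i" if i: "i \<in> I" for i
      unfolding QV_map_def
      by (rule upward_closure_threads[OF i]) (use bond i in \<open>simp add: QV_map_def\<close>)
    ultimately show ?thesis by blast
  qed
  moreover have "\<exists>i\<in>I. \<exists>V. openin (QV_space b (X i)) V \<and> QVpr i Q \<in> V \<and> {R \<in> QV_carrier b lim. QVpr i R \<in> V} \<subseteq> W"
    if W: "openin (QV_space b lim) W" "Q \<in> W" for W Q
  proof -
    have Q: "Q \<in> QV_carrier b lim" using W openin_subset topspace_QV_space by blast
    obtain U where U: "openin (V_space b lim) U" "Q \<subseteq> U" "\<And>R. R \<in> QV_carrier b lim \<Longrightarrow> R \<subseteq> U \<Longrightarrow> R \<in> W"
      using QV_space_neighbourhood[OF W] by metis
    obtain i V where V: "i \<in> I" "openin (V_space b (X i)) V" "Vpr i ` Q \<subseteq> V"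
      "{\<nu> \<in> topspace (V_space b lim). Vpr i \<nu> \<in> V} \<subseteq> U"
      using cone.compact_basis[OF QV_compact[OF Q] U(1,2)] .
    note pr = continuous_map_projection[OF V(1)]
    let ?V = "{R \<in> QV_carrier b (X i). R \<subseteq> V}"
    have "R \<in> W" if R: "R \<in> QV_carrier b lim" "QVpr i R \<in> ?V" for R
    proof (rule U(3)[OF R(1)])
      have "Vpr i ` R \<subseteq> V" using R(2) QV_map_subset_iff[OF pr R(1) V(2)] by simp
      then show "R \<subseteq> U" using V(4) QV_subset[OF R(1)] by auto
    qed
    moreover have "QVpr i Q \<in> ?V"
      using QV_map_in_QV_carrier[OF pr Q] QV_map_subset_iff[OF pr Q V(2)] V(3) by simp
    ultimately show ?thesis using V(1) openin_QV_space_subset[OF V(2)] by blast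
  qed
  ultimately show ?thesis unfolding QV_preserves_limit_iff topspace_QV_space by simp
qed

end

theorem corollary11p5:
  fixes b :: valuation_kind
    and I :: "'i set" and le :: "'i \<Rightarrow> 'i \<Rightarrow> bool"
    and X :: "'i \<Rightarrow> 'a topology" and p :: "'i \<Rightarrow> 'i \<Rightarrow> 'a \<Rightarrow> 'a"
  assumes "projective_system I le X p"
  shows "QV_preserves_limit b I le X p \<longleftrightarrow> V_preserves_limit b I le X p"
  using V_preserves_limit_if_QV_preserves_limit[OF assms] QV_preserves_limit_if_V_preserves_limit[OF assms]
  by blast

end
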